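(* Let $\mathbb F$ be a field and $f$ an $\mathbb F$-valued graph parameter with $f(K_0)=1$ such that there exists an integer $q\ge 0$ such that for every integer $k\ge 0$ there exists an integer $n\ge 2$ with $\operatorname{rk_\mathsf S} T(f,k,n)\le\min(n-1,q^k)$. Then there exists an $\mathbb F$-weighted graph $H$ with $|V(H)|\le q$ such that $f(G)=\hom(G,H)$ for every graph $G$.
   Context: Graphs $G$ are finite, may have multiple edges but no loops; $K_0$ is the empty graph. An $\mathbb F$-valued graph parameter is an isomorphism-invariant function from graphs to $\mathbb F$. An $\mathbb F$-weighted graph $H$ is given by $q'=|V(H)|\ge0$, vertex weights $\alpha_1,\dots,\alpha_{q'}\in\mathbb F\setminus\{0\}$ and a symmetric matrix $B=(\beta_{ij})\in\mathbb F^{q'\times q'}$; $\hom(G,H)=\sum_{\phi:V(G)\to[q']}\prod_{u\in V(G)}\alpha_{\phi(u)}\prod_{uv\in E(G)}\beta_{\phi(u)\phi(v)}$ (edges with multiplicity; empty products equal $1$). For $k\ge 0$, a $k$-labeled graph is a graph in which $k$ distinct nodes carry labels $1,\dots,k$, identified up to label-preserving isomorphism; graph parameters ignore labels. The product of $k$-labeled graphs is the disjoint union with equally-labeled nodes identified. $\mathcal{PLG}[k]$ is the set of $k$-labeled graphs and $U_k$ the edgeless $k$-labeled graph on $k$ nodes. The connection tensor $T(f,k,n)$ is the function $(G_1,\dots,G_n)\mapsto f(G_1\cdots G_n)$ on $\mathcal{PLG}[k]^n$ (for $n=0$ the scalar $f(U_k)$). For $\mathbf x\in\mathbb F^{\mathcal{PLG}[k]}$,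 $\mathbf x^{\otimes n}(G_1,\dots,G_n)=\prod_i\mathbf x(G_i)$, $\mathbf x^{\otimes0}=1$. $\operatorname{rk_\mathsf S}T$ is the least $r\ge0$ with $T=\sum_{i=1}^r\lambda_i\mathbf x_i^{\otimes n}$, $\lambda_i\in\mathbb F$, $\mathbf x_i\in\mathbb F^{\mathcal{PLG}[k]}$ ($\infty$ if none). *)

theory Defs
  imports "HOL-Library.Multiset" "HOL-Library.FuncSet" "HOL-Library.Extended_Nat"
    "HOL-Library.Nat_Bijection"
begin

text \<open>Finite loopless multigraphs. An edge is its two-element set of endpoints, and parallel edges
  are counted by the multiplicity in the multiset. Every finite graph is isomorphic to one
  whose nodes are natural numbers, so this fixed node type loses nothing as long as all notions
  are invariant under isomorphism.\<close>

record mgraph =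
  verts :: "nat set"
  edges :: "nat set multiset"

definition graph :: "mgraph \<Rightarrow> bool" where
  "graph G \<longleftrightarrow> finite (verts G) \<and> (\<forall>e \<in># edges G. e \<subseteq> verts G \<and> card e = 2)"

definition graph_iso :: "(nat \<Rightarrow> nat) \<Rightarrow> mgraph \<Rightarrow> mgraph \<Rightarrow> bool" where
  "graph_iso \<phi> G H \<longleftrightarrow>
     bij_betw \<phi> (verts G) (verts H) \<and> edges H = image_mset ((`) \<phi>) (edges G)"

definition K0 :: mgraph where
  "K0 = \<lparr>verts = {}, edges = {#}\<rparr>"

definition graph_parameter :: "(mgraph \<Rightarrow> 'a) \<Rightarrow> bool" where
  "graph_parameter f \<longleftrightarrow>
     (\<forall>G H. graph G \<and> graph H \<and> (\<exists>\<phi>. graph_iso \<phi> G H) \<longrightarrow> f G = f H)"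

record 'a wgraph =
  wsize :: nat
  vweight :: "nat \<Rightarrow> 'a"
  eweight :: "nat \<Rightarrow> nat \<Rightarrow> 'a"

definition weighted_graph :: "('a::field) wgraph \<Rightarrow> bool" where
  "weighted_graph H \<longleftrightarrow>
     (\<forall>i \<in> {1..wsize H}. vweight H i \<noteq> 0) \<and>
     (\<forall>i \<in> {1..wsize H}. \<forall>j \<in> {1..wsize H}. eweight H i j = eweight H j i)"

text \<open>The minimum and the maximum of an edge are its two endpoints; which of them comes first is
  immaterial, because the edge weights are symmetric.\<close>

definition hom :: "mgraph \<Rightarrow> ('a::field) wgraph \<Rightarrow> 'a" where
  "hom G H =
     (\<Sum>\<phi> \<in> verts G \<rightarrow>\<^sub>E {1..wsize H}.
        (\<Prod>u \<in> verts G. vweight H (\<phi> u)) *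
        (\<Prod>e \<in># edges G. eweight H (\<phi> (Min e)) (\<phi> (Max e))))"

text \<open>In a \<open>k\<close>-labeled graph the node with label \<open>i \<in> {1, \<dots>, k}\<close> is the list entry
  \<open>labels G ! (i - 1)\<close>. The set \<open>PLG k\<close> consists of concrete representatives: \<open>k\<close>-labeled graphs are
  identified up to label-preserving isomorphism by considering only functions on \<open>PLG k\<close> that are
  invariant under it (\<open>PLG_functions\<close>).\<close>

record lgraph =
  unlabel :: mgraph
  labels :: "nat list"

definition PLG :: "nat \<Rightarrow> lgraph set" where
  "PLG k = {G. graph (unlabel G) \<and> length (labels G) = k \<and> distinct (labels G) \<and>
               set (labels G) \<subseteq> verts (unlabel G)}"

definition lgraph_iso :: "(nat \<Rightarrow> nat) \<Rightarrow> lgraph \<Rightarrow> lgraph \<Rightarrow> bool" where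
  "lgraph_iso \<phi> G H \<longleftrightarrow>
     graph_iso \<phi> (unlabel G) (unlabel H) \<and> labels H = map \<phi> (labels G)"

definition PLG_functions :: "nat \<Rightarrow> (lgraph \<Rightarrow> 'a) set" where
  "PLG_functions k =
     {x. \<forall>G \<in> PLG k. \<forall>H \<in> PLG k. (\<exists>\<phi>. lgraph_iso \<phi> G H) \<longrightarrow> x G = x H}"

definition U :: "nat \<Rightarrow> lgraph" where
  "U k = \<lparr>unlabel = \<lparr>verts = {1..k}, edges = {#}\<rparr>, labels = [1..<Suc k]\<rparr>"

text \<open>The product: all nodes of \<open>G\<close> go to the left copy, the unlabeled nodes of \<open>H\<close> to the right copy,
  and a labeled node of \<open>H\<close> is identified with the node of \<open>G\<close> carrying the same label.\<close>

definition glue_left :: "nat \<Rightarrow> nat" where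
  "glue_left v = sum_encode (Inl v)"

definition glue_right :: "lgraph \<Rightarrow> lgraph \<Rightarrow> nat \<Rightarrow> nat" where
  "glue_right G H v =
     (case map_of (zip (labels H) (labels G)) v of
        Some u \<Rightarrow> glue_left u
      | None \<Rightarrow> sum_encode (Inr v))"

definition lprod :: "lgraph \<Rightarrow> lgraph \<Rightarrow> lgraph" where
  "lprod G H =
     \<lparr>unlabel =
        \<lparr>verts = glue_left ` verts (unlabel G) \<union> glue_right G H ` verts (unlabel H),
         edges = image_mset ((`) glue_left) (edges (unlabel G)) +
                 image_mset ((`) (glue_right G H)) (edges (unlabel H))\<rparr>,
      labels = map glue_left (labels G)\<rparr>"

text \<open>Tensors of order \<open>n\<close> on \<open>PLG k\<close> are functions on lists of length \<open>n\<close> over \<open>PLG k\<close>; the order of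
  \<open>conn_tensor f k\<close> is thus the length of its argument. As \<open>U k\<close> is the unit of the product, it
  can serve as the start value, which gives \<open>f (U k)\<close> in order \<open>0\<close>.\<close>

definition conn_tensor :: "(mgraph \<Rightarrow> 'a) \<Rightarrow> nat \<Rightarrow> lgraph list \<Rightarrow> 'a" where
  "conn_tensor f k Gs = f (unlabel (foldr lprod Gs (U k)))"

definition tensor_power :: "(lgraph \<Rightarrow> 'a::field) \<Rightarrow> lgraph list \<Rightarrow> 'a" where
  "tensor_power x Gs = (\<Prod>G \<leftarrow> Gs. x G)"

definition sym_decomposition :: "nat \<Rightarrow> nat \<Rightarrow> (lgraph list \<Rightarrow> 'a::field) \<Rightarrow> nat \<Rightarrow> bool" where
  "sym_decomposition k n T r \<longleftrightarrow>
     (\<exists>c x. (\<forall>i \<in> {1..r}. x i \<in> PLG_functions k) \<and>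
            (\<forall>Gs. length Gs = n \<and> set Gs \<subseteq> PLG k \<longrightarrow>
                  T Gs = (\<Sum>i = 1..r. c i * tensor_power (x i) Gs)))"

text \<open>\<open>sym_rank\<close> is \<open>\<infinity>\<close> if there is no decomposition, this being the infimum of the empty set.\<close>

definition sym_rank :: "nat \<Rightarrow> nat \<Rightarrow> (lgraph list \<Rightarrow> 'a::field) \<Rightarrow> enat" where
  "sym_rank k n T = Inf {enat r | r. sym_decomposition k n T r}"

end

theory Submission
  imports Defs
begin

text \<open>
  Call a graph containing the finite node set \<open>S\<close> an \<open>S\<close>-labeled graph, so that unlabeling is the
  identity. Since the tensor has fewer terms than its order, its terms can be isolated by
  arguments, which forces them to be multiplicative: on \<open>S\<close>-labeled graphs
  \<open>f = (\<Sum>\<chi>\<in>X S. lam S \<chi> * \<chi>)\<close> with at most \<open>q ^ card S\<close> distinct characters \<open>\<chi>\<close> and nonzero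
  coefficients. By linear independence of characters, \<open>X\<close> and \<open>lam\<close> are functorial under
  injections of label sets.

  If \<open>\<chi> \<in> X S\<close> has \<open>D\<close> extensions to one further label, then any choice of extensions for each
  of \<open>m\<close> further labels amalgamates, so \<open>D ^ m \<le> q ^ (card S + m)\<close> for all \<open>m\<close> and hence
  \<open>D \<le> q\<close>. For \<open>\<chi>\<close> with \<open>D\<close> maximal there are no more than \<open>D ^ m\<close> extensions to \<open>m\<close> further
  labels, so each of them is determined by its one-label restrictions. These \<open>D\<close> one-label extensions
  \<open>\<psi>\<close> are the nodes of \<open>H\<close>, with weights \<open>lam \<psi> / lam \<chi>\<close>; the weight of an edge between two of them is
  the value of their amalgam on a single edge. Expanding \<open>\<chi>\<close> over its extensions to all the nodes
  of \<open>G\<close> gives \<open>f G = hom G H\<close>.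
\<close>

section \<open>Linear independence of characters and of powers\<close>

text \<open>Dedekind's argument: subtracting \<open>\<theta> b\<close> times the relation at
  \<open>a\<close> from the relation at the product of \<open>a\<close> and \<open>b\<close> cancels
  the term of \<open>\<theta>\<close> and leaves a shorter relation. In place of an operation on
  \<open>M\<close>, products of values are realised by one \<open>c\<close> for all of
  \<open>X\<close>, which suits graphs that are glued only up to renaming.\<close>

lemma characters_independent:
  fixes X :: "('b \<Rightarrow> 'a::field) set"
  assumes "finite X"
    and "\<And>a b. a \<in> M \<Longrightarrow> b \<in> M \<Longrightarrow> \<exists>c\<in>M. \<forall>\<chi>\<in>X. \<chi> c = \<chi> a * \<chi> b"
    and "\<And>\<chi>. \<chi> \<in> X \<Longrightarrow> \<exists>a\<in>M. \<chi> a \<noteq> 0"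
    and "\<And>\<chi> \<theta>. \<chi> \<in> X \<Longrightarrow> \<theta> \<in> X \<Longrightarrow> \<chi> \<noteq> \<theta> \<Longrightarrow> \<exists>a\<in>M. \<chi> a \<noteq> \<theta> a"
    and "\<And>a. a \<in> M \<Longrightarrow> (\<Sum>\<chi>\<in>X. c \<chi> * \<chi> a) = 0"
    and "\<chi> \<in> X"
  shows "c \<chi> = 0"
  using assms
proof (induction X arbitrary: c \<chi>)
  case empty
  then show ?case by simp
next
  case (insert \<theta> X)
  have X0: "c \<eta> = 0" if \<eta>: "\<eta> \<in> X" for \<eta>
  proof -
    obtain b where b: "b \<in> M" "\<eta> b \<noteq> \<theta> b"
      using insert.prems(3)[of \<eta> \<theta>] \<eta> insert.hyps by auto
    have "(\<Sum>\<chi>\<in>X. (c \<chi> * (\<chi> b - \<theta> b)) * \<chi> a) = 0" if a: "a \<in> M" for a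
    proof -
      obtain d where d: "d \<in> M" "\<forall>\<chi>\<in>insert \<theta> X. \<chi> d = \<chi> a * \<chi> b"
        using insert.prems(1)[OF a b(1)] by blast
      have 1: "c \<theta> * \<theta> d + (\<Sum>\<chi>\<in>X. c \<chi> * \<chi> d) = 0"
        using insert.prems(4)[OF d(1)] insert.hyps by simp
      have 2: "c \<theta> * \<theta> a + (\<Sum>\<chi>\<in>X. c \<chi> * \<chi> a) = 0"
        using insert.prems(4)[OF a] insert.hyps by simp
      have "(\<Sum>\<chi>\<in>X. (c \<chi> * (\<chi> b - \<theta> b)) * \<chi> a)
          = (\<Sum>\<chi>\<in>X. c \<chi> * \<chi> d) - (\<Sum>\<chi>\<in>X. c \<chi> * \<chi> a) * \<theta> b"
      proof -
        have *: "(\<Sum>\<chi>\<in>X. c \<chi> * \<chi> d) = (\<Sum>\<chi>\<in>X. c \<chi> * (\<chi> a * \<chi> b))"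
          using d(2) by (intro sum.cong) auto
        show ?thesis
          unfolding * sum_distrib_right sum_subtractf[symmetric]
          by (intro sum.cong) (auto simp: algebra_simps)
      qed
      also have "\<dots> = - (c \<theta> * \<theta> d) + c \<theta> * \<theta> a * \<theta> b"
        unfolding 1[unfolded add_eq_0_iff] 2[unfolded add_eq_0_iff] by simp
      also have "\<dots> = 0" using d(2) by (simp add: algebra_simps)
      finally show ?thesis .
    qed
    then have "c \<eta> * (\<eta> b - \<theta> b) = 0"
    proof (rule insert.IH[rotated 3])
      show "\<exists>c\<in>M. \<forall>\<chi>\<in>X. \<chi> c = \<chi> a * \<chi> b" if "a \<in> M" "b \<in> M" for a b
        using insert.prems(1)[OF that] by blast
    qed (use \<eta> insert.prems(2,3) in auto)
    then show ?thesis using b by simp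
  qed
  obtain a where a: "a \<in> M" "\<theta> a \<noteq> 0" using insert.prems(2)[of \<theta>] by auto
  have "c \<theta> * \<theta> a + (\<Sum>\<chi>\<in>X. c \<chi> * \<chi> a) = 0"
    using insert.prems(4)[OF a(1)] insert.hyps by simp
  then have "c \<theta> = 0" using X0 a by simp
  then show ?case using X0 insert.prems(5) by auto
qed

text \<open>The \<open>x i\<close>, restricted to \<open>M\<close>, are nonzero and pairwise
  non-proportional, the latter expressed by a nonvanishing 2 by 2 minor.\<close>

definition separated_on :: "'b set \<Rightarrow> 'i set \<Rightarrow> ('i \<Rightarrow> 'b \<Rightarrow> 'a::field) \<Rightarrow> bool" where
  "separated_on M I x \<longleftrightarrow> (\<forall>i\<in>I. \<exists>a\<in>M. x i a \<noteq> 0) \<and>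
     (\<forall>i\<in>I. \<forall>j\<in>I. i \<noteq> j \<longrightarrow> (\<exists>a\<in>M. \<exists>b\<in>M. x i a * x j b \<noteq> x i b * x j a))"

text \<open>Evaluating the first slot at \<open>a\<close> and at \<open>b\<close> and combining the
  results with weights \<open>x l b\<close> and \<open>- x l a\<close> cancels the term
  \<open>l\<close>. One slot is spent per term, which is why \<open>N\<close> slots separate up to
  \<open>Suc N\<close> terms.\<close>

lemma powers_independent:
  fixes x :: "'i \<Rightarrow> 'b \<Rightarrow> 'a::field"
  assumes "finite I" "card I \<le> Suc N" "separated_on M I x"
    and "\<And>as. length as = N \<Longrightarrow> set as \<subseteq> M \<Longrightarrow> (\<Sum>i\<in>I. c i * (\<Prod>a\<leftarrow>as. x i a)) = 0"
    and "i \<in> I"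
  shows "c i = 0"
  using assms
proof (induction N arbitrary: I c i)
  case 0
  then have "I = {i}"
    by (metis One_nat_def card_le_Suc0_iff_eq singleton_iff subsetI subset_antisym)
  with "0.prems"(4)[of "[]"] show ?case by simp
next
  case (Suc N)
  have nz: "\<exists>a\<in>M. x j a \<noteq> 0" if "j \<in> I" for j
    using Suc.prems(3) that unfolding separated_on_def by blast
  show ?case
  proof (cases "I = {i}")
    \<comment> \<open>With no second term to cancel there are still slots left; all are filled with
      one point where \<open>x i\<close> does not vanish.\<close>
    case True
    obtain a where a: "a \<in> M" "x i a \<noteq> 0" using nz Suc.prems(5) by blast
    have "c i * (\<Prod>a\<leftarrow>replicate (Suc N) a. x i a) = 0"
      using Suc.prems(4)[of "replicate (Suc N) a"] a True by (simp add: set_replicate_conv_if)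
    then show ?thesis using a by (simp add: prod_list_replicate)
  next
    case False
    then obtain l where l: "l \<in> I" "l \<noteq> i" using Suc.prems(5) by blast
    obtain a b where ab: "a \<in> M" "b \<in> M" "x i a * x l b \<noteq> x i b * x l a"
      using Suc.prems(3,5) l unfolding separated_on_def by metis
    \<comment> \<open>The factor is the minor of \<open>i\<close> and \<open>l\<close>, nonzero by
      the choice of \<open>a\<close> and \<open>b\<close>. The same expression vanishes for the
      index \<open>l\<close>, so the sum may run over \<open>I - {l}\<close>.\<close>
    have "c i * (x i a * x l b - x i b * x l a) = 0"
    proof (rule Suc.IH[where I = "I - {l}" and c = "\<lambda>i. c i * (x i a * x l b - x i b * x l a)"])
      show "finite (I - {l})" "card (I - {l}) \<le> Suc N" "i \<in> I - {l}"
        using Suc.prems l by auto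
      show "separated_on M (I - {l}) x" using Suc.prems(3) by (auto simp: separated_on_def)
      fix as assume as: "length as = N" "set as \<subseteq> M"
      let ?P = "\<lambda>i. \<Prod>a\<leftarrow>as. x i a"
      have a: "(\<Sum>i\<in>I. c i * (x i a * ?P i)) = 0" using Suc.prems(4)[of "a # as"] as ab by simp
      have b: "(\<Sum>i\<in>I. c i * (x i b * ?P i)) = 0" using Suc.prems(4)[of "b # as"] as ab by simp
      have "(\<Sum>i\<in>I - {l}. c i * (x i a * x l b - x i b * x l a) * ?P i)
          = (\<Sum>i\<in>I. c i * (x i a * x l b - x i b * x l a) * ?P i)"
        by (rule sum.mono_neutral_left) (use Suc.prems in auto)
      also have "\<dots> = x l b * (\<Sum>i\<in>I. c i * (x i a * ?P i)) - x l a * (\<Sum>i\<in>I. c i * (x i b * ?P i))"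
        by (simp add: sum_distrib_left sum_subtractf[symmetric] algebra_simps)
      finally show "(\<Sum>i\<in>I - {l}. c i * (x i a * x l b - x i b * x l a) * ?P i) = 0"
        using a b by simp
    qed
    then show ?thesis using ab by simp
  qed
qed

lemma prod_list_scale:
  "(\<Prod>a\<leftarrow>as. t * g a) = t ^ length as * (\<Prod>a\<leftarrow>as. g a)" for t :: "'a::field"
  by (induction as) (auto simp: algebra_simps)

text \<open>Zero terms are dropped, and a term proportional to another is absorbed by it: if
  \<open>x j = t * x i\<close> on \<open>M\<close>, their powers differ by \<open>t ^ n\<close>, so
  only a coefficient changes and no root has to be taken in the field. As \<open>n \<ge> 1\<close>,
  a function that vanishes on \<open>M\<close> has vanishing power.\<close>

lemma separated_decomposition:
  fixes x :: "'i \<Rightarrow> 'b \<Rightarrow> 'a::field"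
  assumes "finite I" "n \<ge> 1"
  obtains J d where "J \<subseteq> I" "\<forall>i\<in>J. d i \<noteq> 0" "separated_on M J x"
    and "\<And>as. length as = n \<Longrightarrow> set as \<subseteq> M \<Longrightarrow>
           (\<Sum>i\<in>I. c i * (\<Prod>a\<leftarrow>as. x i a)) = (\<Sum>i\<in>J. d i * (\<Prod>a\<leftarrow>as. x i a))"
proof -
  have "\<exists>J d. J \<subseteq> I \<and> (\<forall>i\<in>J. d i \<noteq> 0) \<and> separated_on M J x \<and>
      (\<forall>as. length as = n \<and> set as \<subseteq> M \<longrightarrow>
           (\<Sum>i\<in>I. c i * (\<Prod>a\<leftarrow>as. x i a)) = (\<Sum>i\<in>J. d i * (\<Prod>a\<leftarrow>as. x i a)))"
    using assms(1)
  proof (induction I arbitrary: c rule: finite_psubset_induct)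
    case (psubset I)
    \<comment> \<open>All reductions have this form: delete one index, adjust the coefficients to
      \<open>e\<close>, and apply the induction hypothesis.\<close>
    have remove: ?case
      if j: "j \<in> I" and eq: "\<And>as. length as = n \<Longrightarrow> set as \<subseteq> M \<Longrightarrow>
        (\<Sum>i\<in>I. c i * (\<Prod>a\<leftarrow>as. x i a)) = (\<Sum>i\<in>I - {j}. e i * (\<Prod>a\<leftarrow>as. x i a))" for j e
    proof -
      have "I - {j} \<subset> I" using j by blast
      from psubset.IH[OF this, of e] obtain J d where
        "J \<subseteq> I - {j}" "\<forall>i\<in>J. d i \<noteq> 0" "separated_on M J x"
        "\<forall>as. length as = n \<and> set as \<subseteq> M \<longrightarrow>
           (\<Sum>i\<in>I - {j}. e i * (\<Prod>a\<leftarrow>as. x i a)) = (\<Sum>i\<in>J. d i * (\<Prod>a\<leftarrow>as. x i a))"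
        by blast
      with eq show ?thesis by (intro exI[of _ J] exI[of _ d]) auto
    qed
    consider j where "j \<in> I" "c j = 0" | j where "j \<in> I" "\<forall>a\<in>M. x j a = 0"
      | i j where "i \<in> I" "j \<in> I" "i \<noteq> j" "\<exists>a\<in>M. x i a \<noteq> 0"
          "\<forall>a\<in>M. \<forall>b\<in>M. x i a * x j b = x i b * x j a"
      | "\<forall>i\<in>I. c i \<noteq> 0" "separated_on M I x"
      unfolding separated_on_def by blast
    then show ?case
    proof cases
      case (1 j)
      then show ?thesis by (intro remove[of j c]) (auto simp: sum.remove[OF psubset.hyps(1)])
    next
      case (2 j)
      have "(\<Prod>a\<leftarrow>as. x j a) = 0" if "length as = n" "set as \<subseteq> M" for as
        using that 2 assms(2) by (cases as) auto
      with 2 show ?thesis by (intro remove[of j c]) (auto simp: sum.remove[OF psubset.hyps(1)])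
    next
      case (3 i j)
      then obtain a where a: "a \<in> M" "x i a \<noteq> 0" by blast
      define t where "t = x j a / x i a"
      have t: "x j b = t * x i b" if "b \<in> M" for b
        using 3(5) a that by (auto simp: t_def field_simps)
      have P: "(\<Prod>a\<leftarrow>as. x j a) = t ^ n * (\<Prod>a\<leftarrow>as. x i a)"
        if "length as = n" "set as \<subseteq> M" for as
      proof -
        have "(\<Prod>a\<leftarrow>as. x j a) = (\<Prod>a\<leftarrow>as. t * x i a)"
          using t that(2) by (intro arg_cong[where f = prod_list] map_cong) auto
        then show ?thesis using that by (simp add: prod_list_scale)
      qed
      have i: "i \<in> I - {j}" using 3 by auto
      show ?thesis
      proof (rule remove[OF 3(2), of "c(i := c i + c j * t ^ n)"])
        fix as assume as: "length as = n" "set as \<subseteq> M"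
        let ?P = "\<lambda>i. \<Prod>a\<leftarrow>as. x i a"
        have "(\<Sum>i\<in>I. c i * ?P i) = c j * ?P j + (c i * ?P i + (\<Sum>i\<in>I - {j} - {i}. c i * ?P i))"
          using sum.remove[OF psubset.hyps(1) 3(2), of "\<lambda>i. c i * ?P i"]
            sum.remove[OF _ i, of "\<lambda>i. c i * ?P i"] psubset.hyps(1) by simp
        also have "\<dots> = (c i + c j * t ^ n) * ?P i + (\<Sum>i\<in>I - {j} - {i}. c i * ?P i)"
          using P[OF as] by (simp add: algebra_simps)
        also have "(\<Sum>i\<in>I - {j} - {i}. c i * ?P i) =
            (\<Sum>l\<in>I - {j} - {i}. (c(i := c i + c j * t ^ n)) l * ?P l)"
          by (rule sum.cong) auto
        finally show "(\<Sum>i\<in>I. c i * ?P i) = (\<Sum>l\<in>I - {j}. (c(i := c i + c j * t ^ n)) l * ?P l)"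
          using sum.remove[OF _ i, of "\<lambda>l. (c(i := c i + c j * t ^ n)) l * ?P l"] psubset.hyps(1)
          by simp
      qed
    next
      case 4
      then show ?thesis by (intro exI[of _ I] exI[of _ c]) auto
    qed
  qed
  then show ?thesis using that by blast
qed

section \<open>Gluing graphs along a common label set\<close>

declare sum_encode_eq [simp]

definition rename :: "(nat \<Rightarrow> nat) \<Rightarrow> mgraph \<Rightarrow> mgraph" where
  "rename \<tau> G = \<lparr>verts = \<tau> ` verts G, edges = image_mset ((`) \<tau>) (edges G)\<rparr>"

text \<open>The nodes are not made disjoint: common nodes are identified, so this models the product
  of \<open>S\<close>-labeled graphs provided that
  \<open>verts G \<inter> verts H = S\<close>.\<close>

definition gsum :: "mgraph \<Rightarrow> mgraph \<Rightarrow> mgraph" where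
  "gsum G H = \<lparr>verts = verts G \<union> verts H, edges = edges G + edges H\<rparr>"

definition edgeless :: "nat set \<Rightarrow> mgraph" where
  "edgeless S = \<lparr>verts = S, edges = {#}\<rparr>"

definition graphs_on :: "nat set \<Rightarrow> mgraph set" where
  "graphs_on S = {G. graph G \<and> S \<subseteq> verts G}"

lemma verts_simps [simp]:
  "verts (rename \<tau> G) = \<tau> ` verts G" "verts (gsum G H) = verts G \<union> verts H"
  "verts (edgeless S) = S"
  by (simp_all add: rename_def gsum_def edgeless_def)

lemma edges_simps [simp]:
  "edges (rename \<tau> G) = image_mset ((`) \<tau>) (edges G)" "edges (gsum G H) = edges G + edges H"
  "edges (edgeless S) = {#}"
  by (simp_all add: rename_def gsum_def edgeless_def)

lemma mgraph_eqI: "verts G = verts H \<Longrightarrow> edges G = edges H \<Longrightarrow> G = (H :: mgraph)"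
  by simp

lemma rename_gsum: "rename \<tau> (gsum G H) = gsum (rename \<tau> G) (rename \<tau> H)"
  by (rule mgraph_eqI) (auto simp: image_Un)

lemma rename_edgeless [simp]: "rename \<tau> (edgeless S) = edgeless (\<tau> ` S)"
  by (rule mgraph_eqI) auto

lemma rename_comp: "rename \<tau> (rename \<sigma> G) = rename (\<tau> \<circ> \<sigma>) G"
  by (rule mgraph_eqI) (auto simp: image_comp multiset.map_comp intro!: image_mset_cong)

lemma rename_cong:
  assumes "graph G" "\<And>v. v \<in> verts G \<Longrightarrow> \<tau> v = \<sigma> v"
  shows "rename \<tau> G = rename \<sigma> G"
proof (rule mgraph_eqI)
  show "edges (rename \<tau> G) = edges (rename \<sigma> G)"
    using assms unfolding edges_simps graph_def by (intro image_mset_cong image_cong) auto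
qed (use assms(2) in auto)

lemma rename_id:
  assumes "graph G" "\<And>v. v \<in> verts G \<Longrightarrow> \<tau> v = v"
  shows "rename \<tau> G = G"
proof -
  have "rename \<tau> G = rename id G" using assms by (intro rename_cong) auto
  also have "\<dots> = G" by (rule mgraph_eqI) auto
  finally show ?thesis .
qed

lemma gsum_commute: "gsum G H = gsum H G"
  by (rule mgraph_eqI) auto

lemma gsum_edgeless: "S \<subseteq> verts G \<Longrightarrow> gsum G (edgeless S) = G"
  by (rule mgraph_eqI) auto

lemma graph_edgeless [simp]: "graph (edgeless S) \<longleftrightarrow> finite S"
  by (simp add: graph_def)

lemma graph_gsum [intro]: "graph G \<Longrightarrow> graph H \<Longrightarrow> graph (gsum G H)"
  by (auto simp: graph_def)

lemma graph_rename [intro]: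
  assumes "graph G" "inj_on \<tau> (verts G)"
  shows "graph (rename \<tau> G)"
  using assms unfolding graph_def by (auto simp: card_image inj_on_subset)

lemma graph_iso_iff: "graph_iso \<phi> G H \<longleftrightarrow> inj_on \<phi> (verts G) \<and> H = rename \<phi> G"
  unfolding graph_iso_def bij_betw_def by (auto intro: mgraph_eqI)

lemma lgraph_iso_iff:
  "lgraph_iso \<phi> G H \<longleftrightarrow> inj_on \<phi> (verts (unlabel G)) \<and>
     unlabel H = rename \<phi> (unlabel G) \<and> labels H = map \<phi> (labels G)"
  by (auto simp: lgraph_iso_def graph_iso_iff)

lemma unlabel_lprod:
  "unlabel (lprod G H) = gsum (rename glue_left (unlabel G)) (rename (glue_right G H) (unlabel H))"
  by (rule mgraph_eqI) (auto simp: lprod_def)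

lemma labels_lprod: "labels (lprod G H) = map glue_left (labels G)"
  by (simp add: lprod_def)

lemma inj_glue_left: "inj glue_left"
  by (auto simp: inj_def glue_left_def)

lemma map_of_zip_inj:
  assumes "length xs = length ys" "distinct ys"
    and "map_of (zip xs ys) u = Some w" "map_of (zip xs ys) v = Some w"
  shows "u = v"
proof -
  have "(u, w) \<in> set (zip xs ys)" "(v, w) \<in> set (zip xs ys)"
    using assms(3,4) by (auto dest: map_of_SomeD)
  then obtain i j where "i < length xs" "xs ! i = u" "ys ! i = w" "j < length xs" "xs ! j = v"
      "ys ! j = w"
    using assms(1) by (auto simp: set_zip)
  then show ?thesis using assms(1,2) by (metis nth_eq_iff_index_eq)
qed

lemma inj_glue_right:
  assumes "G \<in> PLG k" "H \<in> PLG k"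
  shows "inj_on (glue_right G H) A"
proof (rule inj_onI)
  fix u v assume "glue_right G H u = glue_right G H v"
  then show "u = v"
    using assms map_of_zip_inj[of "labels H" "labels G"]
    by (auto simp: glue_right_def glue_left_def PLG_def split: option.splits)
qed

lemma lprod_PLG:
  assumes "G \<in> PLG k" "H \<in> PLG k"
  shows "lprod G H \<in> PLG k"
proof -
  have "graph (unlabel (lprod G H))"
    unfolding unlabel_lprod
    by (intro graph_gsum graph_rename inj_glue_right[OF assms] inj_on_subset[OF inj_glue_left])
      (use assms in \<open>auto simp: PLG_def\<close>)
  then show ?thesis
    using assms inj_glue_left
    by (auto simp: PLG_def labels_lprod unlabel_lprod distinct_map intro: inj_on_subset)
qed

definition lgraph_equiv :: "nat \<Rightarrow> lgraph \<Rightarrow> lgraph \<Rightarrow> bool" where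
  "lgraph_equiv k G H \<longleftrightarrow> G \<in> PLG k \<and> H \<in> PLG k \<and> (\<exists>\<phi>. lgraph_iso \<phi> G H)"

lemma lgraph_equiv_trans [trans]:
  assumes "lgraph_equiv k G H" "lgraph_equiv k H K"
  shows "lgraph_equiv k G K"
proof -
  obtain \<phi> \<psi> where "lgraph_iso \<phi> G H" "lgraph_iso \<psi> H K"
    using assms by (auto simp: lgraph_equiv_def)
  then have "lgraph_iso (\<psi> \<circ> \<phi>) G K"
    by (auto simp: lgraph_iso_iff rename_comp intro: comp_inj_on)
  then show ?thesis using assms by (auto simp: lgraph_equiv_def)
qed

text \<open>The isomorphism of the second factors acts on the right copy alone; labeled nodes live
  in the left copy and stay fixed.\<close>

lemma lprod_cong:
  assumes G: "G \<in> PLG k" and "lgraph_equiv k H H'"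
  shows "lgraph_equiv k (lprod G H) (lprod G H')"
proof -
  obtain \<phi> where H: "H \<in> PLG k" "H' \<in> PLG k" and \<phi>: "inj_on \<phi> (verts (unlabel H))"
    "unlabel H' = rename \<phi> (unlabel H)" "labels H' = map \<phi> (labels H)"
    using assms(2) by (auto simp: lgraph_equiv_def lgraph_iso_iff)
  define \<Phi> where "\<Phi> w = (case sum_decode w of Inl a \<Rightarrow> w | Inr v \<Rightarrow> sum_encode (Inr (\<phi> v)))" for w
  have left: "\<Phi> (glue_left v) = glue_left v" for v
    by (simp add: \<Phi>_def glue_left_def)
  have map_of_map: "map_of (zip (map \<phi> xs) ys) (\<phi> v) = map_of (zip xs ys) v"
    if "set xs \<subseteq> verts (unlabel H)" "v \<in> verts (unlabel H)" for xs v and ys :: "nat list"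
    using that
  proof (induction xs arbitrary: ys)
    case (Cons a xs)
    then show ?case using inj_onD[OF \<phi>(1), of v a] by (cases ys) auto
  qed simp
  have right: "\<Phi> (glue_right G H v) = glue_right G H' (\<phi> v)" if "v \<in> verts (unlabel H)" for v
    using map_of_map[OF _ that, of "labels H" "labels G"] H \<phi>(3)
    by (auto simp: \<Phi>_def glue_right_def glue_left_def PLG_def split: option.splits)
  have "inj_on \<Phi> (verts (unlabel (lprod G H)))"
  proof (rule inj_onI)
    fix x y assume xy: "x \<in> verts (unlabel (lprod G H))" "y \<in> verts (unlabel (lprod G H))" "\<Phi> x = \<Phi> y"
    have *: "(\<exists>a. z = sum_encode (Inl a)) \<or> (\<exists>v\<in>verts (unlabel H). z = sum_encode (Inr v))"
      if "z \<in> verts (unlabel (lprod G H))" for z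
      using that
      by (auto simp: unlabel_lprod glue_left_def glue_right_def split: option.splits)
    show "x = y"
      using *[OF xy(1)] *[OF xy(2)] xy(3) inj_onD[OF \<phi>(1)] by (auto simp: \<Phi>_def)
  qed
  moreover have "unlabel (lprod G H') = rename \<Phi> (unlabel (lprod G H))"
  proof -
    have "rename (\<Phi> \<circ> glue_right G H) (unlabel H) = rename (glue_right G H' \<circ> \<phi>) (unlabel H)"
      using right H(1) by (intro rename_cong) (auto simp: PLG_def)
    moreover have "rename (\<Phi> \<circ> glue_left) (unlabel G) = rename glue_left (unlabel G)"
      using left G by (intro rename_cong) (auto simp: PLG_def)
    ultimately show ?thesis
      by (simp add: unlabel_lprod rename_gsum rename_comp \<phi>(2))
  qed
  moreover have "labels (lprod G H') = map \<Phi> (labels (lprod G H))"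
    using left by (simp add: labels_lprod)
  ultimately show ?thesis
    using lprod_PLG[OF G] H by (auto simp: lgraph_equiv_def lgraph_iso_iff)
qed

lemma foldr_lprod_cong:
  assumes "set Gs \<subseteq> PLG k" "lgraph_equiv k G H"
  shows "lgraph_equiv k (foldr lprod Gs G) (foldr lprod Gs H)"
  using assms by (induction Gs) (auto intro: lprod_cong)

text \<open>Labels follow the increasing order of the nodes, so all graphs on \<open>S\<close> give
  the same label to the same node, and their product identifies equal nodes of
  \<open>S\<close>.\<close>

definition label_set :: "nat set \<Rightarrow> mgraph \<Rightarrow> lgraph" where
  "label_set S G = \<lparr>unlabel = G, labels = sorted_list_of_set S\<rparr>"

lemma label_set_simps [simp]:
  "unlabel (label_set S G) = G" "labels (label_set S G) = sorted_list_of_set S"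
  by (simp_all add: label_set_def)

lemma label_set_PLG: "finite S \<Longrightarrow> G \<in> graphs_on S \<Longrightarrow> label_set S G \<in> PLG (card S)"
  by (auto simp: PLG_def graphs_on_def)

lemma edgeless_graphs_on: "finite S \<Longrightarrow> edgeless S \<in> graphs_on S"
  by (auto simp: graphs_on_def)

lemma gsum_graphs_on: "G \<in> graphs_on S \<Longrightarrow> H \<in> graphs_on T \<Longrightarrow> gsum G H \<in> graphs_on (S \<union> T)"
  by (auto simp: graphs_on_def)

text \<open>Forgetting the copy a node comes from is the isomorphism. It is injective because the
  right copy keeps only nodes of \<open>H\<close> outside \<open>S\<close>, none of which is a node
  of \<open>G\<close>.\<close>

lemma lprod_label_set:
  assumes "finite S" "G \<in> graphs_on S" "H \<in> graphs_on S" "verts G \<inter> verts H = S"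
  shows "lgraph_equiv (card S) (lprod (label_set S G) (label_set S H)) (label_set S (gsum G H))"
proof -
  let ?G = "label_set S G" and ?H = "label_set S H"
  have PLG: "?G \<in> PLG (card S)" "?H \<in> PLG (card S)" "label_set S (gsum G H) \<in> PLG (card S)"
    using label_set_PLG gsum_graphs_on[OF assms(2,3)] assms by auto
  define \<Phi> where "\<Phi> w = (case sum_decode w of Inl a \<Rightarrow> a | Inr b \<Rightarrow> b)" for w
  have left: "\<Phi> (glue_left v) = v" for v by (simp add: \<Phi>_def glue_left_def)
  have map_of: "map_of (zip xs xs) v = (if v \<in> set xs then Some v else None)" for v and xs :: "nat list"
    by (induction xs) auto
  have right: "\<Phi> (glue_right ?G ?H v) = v" for v
    using map_of by (auto simp: \<Phi>_def glue_right_def glue_left_def)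
  have "inj_on \<Phi> (verts (unlabel (lprod ?G ?H)))"
  proof (rule inj_onI)
    fix x y assume xy: "x \<in> verts (unlabel (lprod ?G ?H))" "y \<in> verts (unlabel (lprod ?G ?H))" "\<Phi> x = \<Phi> y"
    have *: "(\<exists>a\<in>verts G. z = sum_encode (Inl a)) \<or> (\<exists>v\<in>verts H - S. z = sum_encode (Inr v))"
      if "z \<in> verts (unlabel (lprod ?G ?H))" for z
      using that assms
      by (auto simp: unlabel_lprod glue_left_def glue_right_def map_of graphs_on_def split: if_splits)
    show "x = y"
      using *[OF xy(1)] *[OF xy(2)] xy(3) assms(4) by (auto simp: \<Phi>_def)
  qed
  moreover have "rename \<Phi> (unlabel (lprod ?G ?H)) = gsum G H"
    using left right assms(2,3)
    by (auto simp: unlabel_lprod rename_gsum rename_comp graphs_on_def intro!: arg_cong2[where f = gsum] rename_id)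
  moreover have "map \<Phi> (labels (lprod ?G ?H)) = sorted_list_of_set S"
    using left by (auto simp: labels_lprod intro: map_idI)
  ultimately show ?thesis
    using lprod_PLG PLG by (auto simp: lgraph_equiv_def lgraph_iso_iff)
qed

lemma U_equiv_edgeless:
  assumes "finite S"
  shows "lgraph_equiv (card S) (U (card S)) (label_set S (edgeless S))"
proof -
  let ?ls = "sorted_list_of_set S"
  have "inj_on (\<lambda>i. ?ls ! (i - 1)) {1..card S}"
    by (auto simp: inj_on_def nth_eq_iff_index_eq)
  moreover have map: "map (\<lambda>i. ?ls ! (i - 1)) [1..<Suc (card S)] = ?ls"
    by (rule nth_equalityI) (auto simp: nth_append simp del: upt_Suc)
  moreover have "(\<lambda>i. ?ls ! (i - 1)) ` {1..card S} = S"
    using arg_cong[OF map, of set] assms by (simp add: atLeastLessThanSuc_atLeastAtMost del: upt_Suc)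
  moreover have "U (card S) \<in> PLG (card S)"
    by (auto simp: U_def PLG_def graph_def)
  ultimately show ?thesis
    using label_set_PLG[OF assms edgeless_graphs_on[OF assms]]
    unfolding lgraph_equiv_def lgraph_iso_iff
    by (intro conjI exI[of _ "\<lambda>i. ?ls ! (i - 1)"])
      (simp_all add: U_def edgeless_def rename_def del: upt_Suc)
qed

lemma lprod_U:
  assumes "finite S" "G \<in> graphs_on S"
  shows "lgraph_equiv (card S) (lprod (label_set S G) (U (card S))) (label_set S G)"
proof -
  have "lgraph_equiv (card S) (lprod (label_set S G) (U (card S)))
      (lprod (label_set S G) (label_set S (edgeless S)))"
    by (intro lprod_cong label_set_PLG U_equiv_edgeless assms)
  also have "lgraph_equiv (card S) \<dots> (label_set S (gsum G (edgeless S)))"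
    by (intro lprod_label_set assms edgeless_graphs_on) (use assms in \<open>auto simp: graphs_on_def\<close>)
  finally show ?thesis using assms(2) by (simp add: gsum_edgeless graphs_on_def)
qed

lemma graph_parameter_lgraph_equiv:
  assumes "graph_parameter f" "lgraph_equiv k G H"
  shows "f (unlabel G) = f (unlabel H)"
  using assms unfolding graph_parameter_def lgraph_equiv_def PLG_def lgraph_iso_def by blast

text \<open>Both lists have the same product, and the unit fills the place freed by gluing
  \<open>G\<close> to \<open>H\<close>, so the order of the tensor is kept. Comparing the two values
  is what makes the terms of a decomposition multiplicative.\<close>

lemma conn_tensor_gsum:
  assumes f: "graph_parameter f" and S: "finite S" and G: "G \<in> graphs_on S"
    and H: "H \<in> graphs_on S" and GH: "verts G \<inter> verts H = S" and Gs: "set Gs \<subseteq> graphs_on S"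
  shows "conn_tensor f (card S) (map (label_set S) (Gs @ [G, H]))
       = conn_tensor f (card S) (map (label_set S) (Gs @ [gsum G H, edgeless S]))"
proof -
  let ?k = "card S"
  have GsP: "set (map (label_set S) Gs) \<subseteq> PLG ?k" using Gs label_set_PLG[OF S] by auto
  have GHS: "gsum G H \<in> graphs_on S" using gsum_graphs_on[OF G H] by simp
  have "lgraph_equiv ?k (foldr lprod (map (label_set S) [G, H]) (U ?k)) (lprod (label_set S G) (label_set S H))"
    using lprod_cong[OF label_set_PLG[OF S G] lprod_U[OF S H]] by simp
  also have "lgraph_equiv ?k \<dots> (label_set S (gsum G H))"
    by (intro lprod_label_set assms)
  finally have 1: "lgraph_equiv ?k (foldr lprod (map (label_set S) [G, H]) (U ?k)) \<dots>" .
  have "lgraph_equiv ?k (foldr lprod (map (label_set S) [gsum G H, edgeless S]) (U ?k))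
      (lprod (label_set S (gsum G H)) (label_set S (edgeless S)))"
    using lprod_cong[OF label_set_PLG[OF S GHS] lprod_U[OF S edgeless_graphs_on[OF S]]] by simp
  also have "lgraph_equiv ?k \<dots> (label_set S (gsum (gsum G H) (edgeless S)))"
    by (intro lprod_label_set GHS S edgeless_graphs_on) (use GHS in \<open>auto simp: graphs_on_def\<close>)
  also have "gsum (gsum G H) (edgeless S) = gsum G H"
    using GHS by (intro gsum_edgeless) (auto simp: graphs_on_def)
  finally have 2: "lgraph_equiv ?k (foldr lprod (map (label_set S) [gsum G H, edgeless S]) (U ?k))
      (label_set S (gsum G H))" .
  show ?thesis
    using graph_parameter_lgraph_equiv[OF f foldr_lprod_cong[OF GsP 1]]
      graph_parameter_lgraph_equiv[OF f foldr_lprod_cong[OF GsP 2]]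
    by (simp add: conn_tensor_def)
qed

text \<open>Filling the remaining places with units recovers \<open>f\<close> itself from a tensor
  of any positive order.\<close>

lemma conn_tensor_edgeless:
  assumes f: "graph_parameter f" and S: "finite S" and G: "G \<in> graphs_on S"
  shows "conn_tensor f (card S) (map (label_set S) (G # replicate n (edgeless S))) = f G"
proof -
  let ?k = "card S"
  have E: "lgraph_equiv ?k (foldr lprod (map (label_set S) (replicate n (edgeless S))) (U ?k))
      (label_set S (edgeless S))"
  proof (induction n)
    case 0
    then show ?case using U_equiv_edgeless[OF S] by simp
  next
    case (Suc n)
    have "lgraph_equiv ?k (lprod (label_set S (edgeless S)) (label_set S (edgeless S)))
        (label_set S (gsum (edgeless S) (edgeless S)))"
      by (intro lprod_label_set S edgeless_graphs_on) auto
    then show ?case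
      using lgraph_equiv_trans[OF lprod_cong[OF label_set_PLG[OF S edgeless_graphs_on[OF S]] Suc.IH]]
      by (simp add: gsum_edgeless)
  qed
  have "lgraph_equiv ?k (lprod (label_set S G) (label_set S (edgeless S)))
      (label_set S (gsum G (edgeless S)))"
    by (intro lprod_label_set S G edgeless_graphs_on) (use G in \<open>auto simp: graphs_on_def\<close>)
  then have "lgraph_equiv ?k (lprod (label_set S G) (label_set S (edgeless S))) (label_set S G)"
    using G by (simp add: gsum_edgeless graphs_on_def)
  from graph_parameter_lgraph_equiv[OF f
      lgraph_equiv_trans[OF lprod_cong[OF label_set_PLG[OF S G] E] this]]
  show ?thesis by (simp add: conn_tensor_def)
qed

section \<open>From symmetric decompositions to characters\<close>

text \<open>These are the unital homomorphisms to the field from the monoid of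
  \<open>S\<close>-labeled graphs up to isomorphism fixing the labels. The value 0 outside
  \<open>graphs_on S\<close> makes them, as functions, determined by their values on
  \<open>S\<close>-labeled graphs.\<close>

definition chars :: "nat set \<Rightarrow> (mgraph \<Rightarrow> 'a::field) set" where
  "chars S = {\<chi>. (\<forall>G. G \<notin> graphs_on S \<longrightarrow> \<chi> G = 0) \<and>
     (\<forall>G\<in>graphs_on S. \<forall>\<tau>. inj_on \<tau> (verts G) \<and> (\<forall>v\<in>S. \<tau> v = v) \<longrightarrow> \<chi> (rename \<tau> G) = \<chi> G) \<and>
     \<chi> (edgeless S) = 1 \<and>
     (\<forall>G\<in>graphs_on S. \<forall>H\<in>graphs_on S. verts G \<inter> verts H = S \<longrightarrow> \<chi> (gsum G H) = \<chi> G * \<chi> H)}"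

lemma chars_outside: "\<chi> \<in> chars S \<Longrightarrow> G \<notin> graphs_on S \<Longrightarrow> \<chi> G = 0"
  and chars_rename: "\<chi> \<in> chars S \<Longrightarrow> G \<in> graphs_on S \<Longrightarrow> inj_on \<tau> (verts G) \<Longrightarrow>
    (\<And>v. v \<in> S \<Longrightarrow> \<tau> v = v) \<Longrightarrow> \<chi> (rename \<tau> G) = \<chi> G"
  and chars_edgeless: "\<chi> \<in> chars S \<Longrightarrow> \<chi> (edgeless S) = 1"
  and chars_gsum: "\<chi> \<in> chars S \<Longrightarrow> G \<in> graphs_on S \<Longrightarrow> H \<in> graphs_on S \<Longrightarrow> verts G \<inter> verts H = S \<Longrightarrow>
    \<chi> (gsum G H) = \<chi> G * \<chi> H"
  unfolding chars_def by blast+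

text \<open>Every element of a finite \<open>A\<close> is at most \<open>\<Sum>A\<close>, so the
  nodes outside \<open>S\<close> move beyond \<open>A\<close>. If \<open>A\<close> contains
  \<open>S\<close>, the result is a copy that meets \<open>A\<close> in \<open>S\<close>
  only.\<close>

definition shift :: "nat set \<Rightarrow> nat set \<Rightarrow> nat \<Rightarrow> nat" where
  "shift S A v = (if v \<in> S then v else v + Suc (\<Sum>A))"

lemma shift_fresh:
  assumes "finite A" shows "v + Suc (\<Sum>A) \<notin> A"
proof
  assume "v + Suc (\<Sum>A) \<in> A"
  then have "v + Suc (\<Sum>A) \<le> \<Sum>A" using assms by (intro member_le_sum) auto
  then show False by simp
qed

lemma shift_same [simp]: "v \<in> S \<Longrightarrow> shift S A v = v"
  by (simp add: shift_def)

lemma shift_notin: "finite A \<Longrightarrow> v \<notin> S \<Longrightarrow> shift S A v \<notin> A"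
  using shift_fresh by (simp add: shift_def)

lemma inj_shift:
  assumes "finite A" "S \<subseteq> A" shows "inj_on (shift S A) B"
proof (rule inj_onI)
  fix x y assume "shift S A x = shift S A y"
  then show "x = y"
    using shift_fresh[OF assms(1)] assms(2) by (auto simp: shift_def split: if_splits)
qed

lemma shift_image: "S \<subseteq> B \<Longrightarrow> finite A \<Longrightarrow> shift S A ` B \<inter> A = S \<inter> A"
  using shift_notin[of A _ S] by (auto simp: image_iff) (metis shift_same subsetD)+

lemma graph_rename_shift:
  assumes "G \<in> graphs_on S" "finite A" "S \<subseteq> A"
  shows "rename (shift S A) G \<in> graphs_on S" "verts (rename (shift S A) G) \<inter> A = S"
proof -
  have "S \<subseteq> shift S A ` verts G" using assms(1) by (force simp: graphs_on_def)
  then show "rename (shift S A) G \<in> graphs_on S"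
    using assms by (auto simp: graphs_on_def intro: inj_shift)
  show "verts (rename (shift S A) G) \<inter> A = S"
    using assms shift_image[of S "verts G" A] by (auto simp: graphs_on_def)
qed

lemma chars_shift:
  assumes "\<chi> \<in> chars S" "G \<in> graphs_on S" "finite A" "S \<subseteq> A"
  shows "\<chi> (rename (shift S A) G) = \<chi> G"
  using assms by (intro chars_rename inj_shift) auto

text \<open>\<open>G\<close> and \<open>H\<close> may share nodes outside \<open>S\<close>, so a
  fresh copy of \<open>H\<close> is glued instead. The copy does not depend on
  \<open>\<chi>\<close>, as \<open>characters_independent\<close> requires.\<close>

lemma chars_mult:
  assumes "G \<in> graphs_on S" "H \<in> graphs_on S"
  shows "\<exists>K\<in>graphs_on S. \<forall>\<chi>\<in>chars S. \<chi> K = (\<chi> G * \<chi> H :: 'a::field)"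
proof -
  let ?H = "rename (shift S (verts G)) H"
  have fin: "finite (verts G)" "S \<subseteq> verts G" using assms by (auto simp: graphs_on_def graph_def)
  note H = graph_rename_shift[OF assms(2) fin]
  have "gsum G ?H \<in> graphs_on S" using gsum_graphs_on[OF assms(1) H(1)] by simp
  moreover have "\<chi> (gsum G ?H) = \<chi> G * \<chi> H" if "\<chi> \<in> chars S" for \<chi> :: "mgraph \<Rightarrow> 'a"
    using chars_gsum[OF that assms(1) H(1)] H(2) chars_shift[OF that assms(2) fin]
    by (simp add: Int_commute)
  ultimately show ?thesis by blast
qed

lemma chars_eqI:
  assumes "\<chi> \<in> chars S" "\<theta> \<in> chars S" "\<And>G. G \<in> graphs_on S \<Longrightarrow> \<chi> G = \<theta> G"
  shows "\<chi> = \<theta>"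
proof
  show "\<chi> G = \<theta> G" for G
    using assms(3) chars_outside[OF assms(1), of G] chars_outside[OF assms(2), of G]
    by (cases "G \<in> graphs_on S") simp_all
qed

lemma chars_independent:
  fixes X :: "(mgraph \<Rightarrow> 'a::field) set"
  assumes "finite S" "finite X" "X \<subseteq> chars S" "\<And>G. G \<in> graphs_on S \<Longrightarrow> (\<Sum>\<chi>\<in>X. c \<chi> * \<chi> G) = 0"
    and "\<chi> \<in> X"
  shows "c \<chi> = 0"
proof (rule characters_independent[OF assms(2) _ _ _ assms(4,5)])
  show "\<exists>c\<in>graphs_on S. \<forall>\<chi>\<in>X. \<chi> c = \<chi> a * \<chi> b" if "a \<in> graphs_on S" "b \<in> graphs_on S" for a b
    using chars_mult[OF that] assms(3) by blast
  show "\<exists>a\<in>graphs_on S. \<chi> a \<noteq> 0" if "\<chi> \<in> X" for \<chi>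
    using that assms(3) chars_edgeless[of \<chi> S] edgeless_graphs_on[OF assms(1)]
    by (metis one_neq_zero subsetD)
  show "\<exists>a\<in>graphs_on S. \<chi> a \<noteq> \<theta> a" if "\<chi> \<in> X" "\<theta> \<in> X" "\<chi> \<noteq> \<theta>" for \<chi> \<theta>
    using that assms(3) chars_eqI by blast
qed

text \<open>Comparison of coefficients when the family \<open>p\<close> may repeat characters: equal
  ones are grouped, \<open>X\<close> is padded with zero coefficients, and independence applies to
  the union of both families. A \<open>\<theta>\<close> in neither family gives zero on both
  sides.\<close>

lemma chars_coeff_eq:
  fixes p :: "'i \<Rightarrow> mgraph \<Rightarrow> 'a::field" and X :: "(mgraph \<Rightarrow> 'a) set"
  assumes S: "finite S" and fin: "finite I" "finite X" and p: "p ` I \<subseteq> chars S" and X: "X \<subseteq> chars S"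
    and eq: "\<And>G. G \<in> graphs_on S \<Longrightarrow> (\<Sum>i\<in>I. c i * p i G) = (\<Sum>\<chi>\<in>X. d \<chi> * \<chi> G)"
  shows "(\<Sum>i | i \<in> I \<and> p i = \<theta>. c i) = (if \<theta> \<in> X then d \<theta> else 0)"
proof (cases "\<theta> \<in> p ` I \<union> X")
  case True
  let ?Y = "p ` I \<union> X"
  let ?d = "\<lambda>\<chi>. if \<chi> \<in> X then d \<chi> else 0"
  have group: "(\<Sum>i\<in>I. c i * p i G) = (\<Sum>\<chi>\<in>?Y. (\<Sum>i | i \<in> I \<and> p i = \<chi>. c i) * \<chi> G)" for G
  proof -
    have "(\<Sum>i\<in>I. c i * p i G) = (\<Sum>\<chi>\<in>?Y. \<Sum>i | i \<in> I \<and> p i = \<chi>. c i * p i G)"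
      using fin by (intro sum.group[symmetric]) auto
    also have "\<dots> = (\<Sum>\<chi>\<in>?Y. (\<Sum>i | i \<in> I \<and> p i = \<chi>. c i) * \<chi> G)"
      by (simp add: sum_distrib_right)
    finally show ?thesis .
  qed
  have pad: "(\<Sum>\<chi>\<in>X. d \<chi> * \<chi> G) = (\<Sum>\<chi>\<in>?Y. ?d \<chi> * \<chi> G)" for G
    using fin by (intro sum.mono_neutral_cong_left) auto
  have "(\<Sum>i | i \<in> I \<and> p i = \<theta>. c i) - ?d \<theta> = 0"
  proof (rule chars_independent[OF S, of ?Y "\<lambda>\<theta>. (\<Sum>i | i \<in> I \<and> p i = \<theta>. c i) - ?d \<theta>"])
    fix G assume "G \<in> graphs_on S"
    from eq[OF this] show "(\<Sum>\<chi>\<in>?Y. ((\<Sum>i | i \<in> I \<and> p i = \<chi>. c i) - ?d \<chi>) * \<chi> G) = 0"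
      unfolding group pad left_diff_distrib sum_subtractf by simp
  qed (use fin p X True in auto)
  then show ?thesis by simp
next
  case False
  then have "{i. i \<in> I \<and> p i = \<theta>} = {}" by auto
  with False show ?thesis by (simp only: sum.empty) simp
qed

lemma lgraph_iso_label_set:
  assumes "finite S" "inj_on \<tau> (verts G)" "\<And>v. v \<in> S \<Longrightarrow> \<tau> v = v"
  shows "lgraph_iso \<tau> (label_set S G) (label_set S (rename \<tau> G))"
  using assms by (auto simp: lgraph_iso_iff intro!: map_idI[symmetric])

text \<open>\<open>mult\<close> is multiplicativity up to the value at the unit; dividing by that
  value makes it exact and sends the unit to 1.\<close>

lemma normalized_in_chars:
  fixes y :: "lgraph \<Rightarrow> 'a::field"
  assumes S: "finite S" and y: "y \<in> PLG_functions (card S)"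
    and E: "y (label_set S (edgeless S)) \<noteq> 0"
    and mult: "\<And>G H. G \<in> graphs_on S \<Longrightarrow> H \<in> graphs_on S \<Longrightarrow> verts G \<inter> verts H = S \<Longrightarrow>
      y (label_set S G) * y (label_set S H) = y (label_set S (gsum G H)) * y (label_set S (edgeless S))"
  shows "(\<lambda>G. if G \<in> graphs_on S then y (label_set S G) / y (label_set S (edgeless S)) else 0) \<in> chars S"
  unfolding chars_def mem_Collect_eq
proof (intro conjI allI ballI impI)
  fix G \<tau> assume G: "G \<in> graphs_on S" and \<tau>: "inj_on \<tau> (verts G) \<and> (\<forall>v\<in>S. \<tau> v = v)"
  have \<tau>G: "rename \<tau> G \<in> graphs_on S" using G \<tau> by (force simp: graphs_on_def)
  have "y (label_set S G) = y (label_set S (rename \<tau> G))"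
    using y lgraph_iso_label_set[OF S, of \<tau> G] label_set_PLG[OF S G] label_set_PLG[OF S \<tau>G] \<tau>
    unfolding PLG_functions_def by blast
  then show "(if rename \<tau> G \<in> graphs_on S then y (label_set S (rename \<tau> G)) / y (label_set S (edgeless S)) else 0)
      = (if G \<in> graphs_on S then y (label_set S G) / y (label_set S (edgeless S)) else 0)"
    using G \<tau>G by simp
next
  fix G H assume "G \<in> graphs_on S" "H \<in> graphs_on S" "verts G \<inter> verts H = S"
  from this mult[OF this] gsum_graphs_on[OF this(1,2)] E
  show "(if gsum G H \<in> graphs_on S then y (label_set S (gsum G H)) / y (label_set S (edgeless S)) else 0) =
      (if G \<in> graphs_on S then y (label_set S G) / y (label_set S (edgeless S)) else 0) *
      (if H \<in> graphs_on S then y (label_set S H) / y (label_set S (edgeless S)) else 0)"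
    by (simp add: field_simps)
qed (use E edgeless_graphs_on[OF S] in auto)

text \<open>A decomposition of order \<open>n\<close> with fewer than \<open>n\<close> terms can be tested on \<open>n - 2\<close> arguments
  that isolate a single term. Comparing the arguments \<open>G, H\<close> with \<open>G H, U\<close> in the last
  two places shows that every term is a multiple of a power of a character.\<close>

lemma character_decomposition:
  fixes f :: "mgraph \<Rightarrow> 'a::field"
  assumes f: "graph_parameter f" and S: "finite S" and n: "n \<ge> 2" "r \<le> n - 1"
    and dec: "sym_decomposition (card S) n (conn_tensor f (card S)) r"
  shows "\<exists>X l. finite X \<and> card X \<le> r \<and> X \<subseteq> chars S \<and> (\<forall>\<chi>\<in>X. l \<chi> \<noteq> 0) \<and>
    (\<forall>G\<in>graphs_on S. f G = (\<Sum>\<chi>\<in>X. l \<chi> * \<chi> G))"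
proof -
  obtain c y where y: "\<And>i. i \<in> {1..r} \<Longrightarrow> y i \<in> PLG_functions (card S)"
    and cy: "\<And>Gs. length Gs = n \<Longrightarrow> set Gs \<subseteq> PLG (card S) \<Longrightarrow>
      conn_tensor f (card S) Gs = (\<Sum>i = 1..r. c i * tensor_power (y i) Gs)"
    using dec unfolding sym_decomposition_def by blast
  define x where "x i G = y i (label_set S G)" for i G
  have cx: "conn_tensor f (card S) (map (label_set S) Gs) = (\<Sum>i = 1..r. c i * (\<Prod>G\<leftarrow>Gs. x i G))"
    if "length Gs = n" "set Gs \<subseteq> graphs_on S" for Gs
  proof -
    have "set (map (label_set S) Gs) \<subseteq> PLG (card S)" using that label_set_PLG[OF S] by auto
    from cy[OF _ this] that show ?thesis by (simp add: tensor_power_def x_def o_def)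
  qed
  obtain J d where J: "J \<subseteq> {1..r}" "\<forall>i\<in>J. d i \<noteq> 0" "separated_on (graphs_on S) J x"
    and Jd: "\<And>Gs. length Gs = n \<Longrightarrow> set Gs \<subseteq> graphs_on S \<Longrightarrow>
      (\<Sum>i = 1..r. c i * (\<Prod>G\<leftarrow>Gs. x i G)) = (\<Sum>i\<in>J. d i * (\<Prod>G\<leftarrow>Gs. x i G))"
    by (rule separated_decomposition[where I = "{1..r}" and n = n and M = "graphs_on S" and x = x and c = c])
      (use n in auto)
  have finJ: "finite J" using J(1) finite_subset by auto
  have cardJ: "card J \<le> r" using card_mono[OF _ J(1)] by simp
  let ?E = "edgeless S"
  have E: "?E \<in> graphs_on S" using edgeless_graphs_on[OF S] .
  have mult: "x i G * x i H = x i (gsum G H) * x i ?E"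
    if i: "i \<in> J" and G: "G \<in> graphs_on S" "H \<in> graphs_on S" "verts G \<inter> verts H = S" for i G H
  proof -
    have GH: "gsum G H \<in> graphs_on S" using gsum_graphs_on[OF G(1,2)] by simp
    \<comment> \<open>The first \<open>n - 2\<close> places carry the test arguments. Since
      \<open>card J \<le> r \<le> n - 1 = Suc (n - 2)\<close>, they are just enough to isolate one
      term.\<close>
    have "d i * (x i G * x i H - x i (gsum G H) * x i ?E) = 0"
    proof (rule powers_independent[OF finJ _ J(3) _ i, where N = "n - 2"
          and c = "\<lambda>i. d i * (x i G * x i H - x i (gsum G H) * x i ?E)"])
      show "card J \<le> Suc (n - 2)" using cardJ n by simp
      fix Gs assume Gs: "length Gs = n - 2" "set Gs \<subseteq> graphs_on S"
      have "(\<Sum>i\<in>J. d i * (\<Prod>K\<leftarrow>Gs @ [G, H]. x i K)) = (\<Sum>i\<in>J. d i * (\<Prod>K\<leftarrow>Gs @ [gsum G H, ?E]. x i K))"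
        using conn_tensor_gsum[OF f S G Gs(2)] cx[of "Gs @ [G, H]"] cx[of "Gs @ [gsum G H, ?E]"]
          Jd[of "Gs @ [G, H]"] Jd[of "Gs @ [gsum G H, ?E]"] Gs G GH E n
        by simp
      then show "(\<Sum>i\<in>J. d i * (x i G * x i H - x i (gsum G H) * x i ?E) * (\<Prod>K\<leftarrow>Gs. x i K)) = 0"
        by (simp add: algebra_simps sum_subtractf)
    qed
    then show ?thesis using J(2) i by simp
  qed
  have inv: "x i (rename \<tau> G) = x i G"
    if "i \<in> J" "G \<in> graphs_on S" "inj_on \<tau> (verts G)" "\<And>v. v \<in> S \<Longrightarrow> \<tau> v = v" for i \<tau> G
  proof -
    have "rename \<tau> G \<in> graphs_on S" using that by (force simp: graphs_on_def)
    then have "label_set S (rename \<tau> G) \<in> PLG (card S)" "label_set S G \<in> PLG (card S)"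
      using that label_set_PLG[OF S] by auto
    with y[of i] J(1) lgraph_iso_label_set[OF S, of \<tau> G] that show ?thesis
      unfolding x_def PLG_functions_def by fastforce
  qed
  \<comment> \<open>Otherwise \<open>mult\<close> gives product zero for \<open>G\<close> and a
    fresh copy of \<open>G\<close>, on which \<open>x i\<close> takes the same nonzero value as on
    \<open>G\<close>.\<close>
  have xE: "x i ?E \<noteq> 0" if i: "i \<in> J" for i
  proof
    assume 0: "x i ?E = 0"
    obtain G where G: "G \<in> graphs_on S" "x i G \<noteq> 0" using J(3) i unfolding separated_on_def by blast
    have fin: "finite (verts G)" "S \<subseteq> verts G" using G by (auto simp: graphs_on_def graph_def)
    have "x i G * x i (rename (shift S (verts G)) G) = 0"
      using mult[OF i G(1) graph_rename_shift(1)[OF G(1) fin]] graph_rename_shift(2)[OF G(1) fin] 0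
      by (simp add: Int_commute)
    moreover have "x i (rename (shift S (verts G)) G) = x i G"
      using inv[OF i G(1) inj_shift[OF fin]] by simp
    ultimately show False using G by simp
  qed
  define \<chi> where "\<chi> i = (\<lambda>G. if G \<in> graphs_on S then x i G / x i ?E else 0)" for i
  have \<chi>: "\<chi> i \<in> chars S" if "i \<in> J" for i
    unfolding \<chi>_def x_def
    using normalized_in_chars[OF S y xE[OF that, unfolded x_def] mult[OF that, unfolded x_def]] J(1) that by blast
  \<comment> \<open>Equal normalizations would make \<open>x i\<close> and \<open>x j\<close>
    proportional, against separation.\<close>
  have inj: "inj_on \<chi> J"
  proof (rule inj_onI, rule ccontr)
    fix i j assume ij: "i \<in> J" "j \<in> J" "\<chi> i = \<chi> j" "i \<noteq> j"
    then obtain G H where GH: "G \<in> graphs_on S" "H \<in> graphs_on S" "x i G * x j H \<noteq> x i H * x j G"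
      using J(3) unfolding separated_on_def by blast
    have "x i K / x i ?E = x j K / x j ?E" if "K \<in> graphs_on S" for K
      using fun_cong[OF ij(3), of K] that by (simp add: \<chi>_def)
    then have "x i K = x j K * (x i ?E / x j ?E)" if "K \<in> graphs_on S" for K
      using xE ij that by (simp add: field_simps)
    with GH show False by (simp add: algebra_simps)
  qed
  \<comment> \<open>The list \<open>?Gs\<close> below contains \<open>G\<close> once and the unit
    \<open>n - 1\<close> times; normalizing the factor of \<open>G\<close> contributes one more
    \<open>x i ?E\<close>, hence the exponent \<open>n\<close>. Coefficients are indexed by
    characters, hence the inverse of \<open>\<chi>\<close>.\<close>
  define l where "l \<theta> = (let i = the_inv_into J \<chi> \<theta> in d i * x i ?E ^ n)" for \<theta>
  have l: "l (\<chi> i) = d i * x i ?E ^ n" if "i \<in> J" for i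
    using that inj by (simp add: l_def the_inv_into_f_f)
  show ?thesis
  proof (intro exI[of _ "\<chi> ` J"] exI[of _ l] conjI ballI)
    show "card (\<chi> ` J) \<le> r" using card_image_le[OF finJ, of \<chi>] cardJ by simp
    fix G assume G: "G \<in> graphs_on S"
    let ?Gs = "G # replicate (n - 1) ?E"
    have "f G = (\<Sum>i\<in>J. d i * (\<Prod>K\<leftarrow>?Gs. x i K))"
      using conn_tensor_edgeless[OF f S G, of "n - 1"] cx[of ?Gs] Jd[of ?Gs] G E n
      by (auto simp: set_replicate_conv_if)
    also have "\<dots> = (\<Sum>i\<in>J. l (\<chi> i) * \<chi> i G)"
    proof (rule sum.cong)
      fix i assume i: "i \<in> J"
      have "x i ?E ^ n = x i ?E * x i ?E ^ (n - 1)" using n by (simp add: power_eq_if)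
      then show "d i * (\<Prod>K\<leftarrow>?Gs. x i K) = l (\<chi> i) * \<chi> i G"
        using l[OF i] xE[OF i] G by (simp add: \<chi>_def map_replicate prod_list_replicate)
    qed simp
    finally show "f G = (\<Sum>\<theta>\<in>\<chi> ` J. l \<theta> * \<theta> G)" using inj by (simp add: sum.reindex)
  qed (use finJ \<chi> l J(2) xE in auto)
qed

section \<open>Pullback of characters along injections of labels\<close>

definition extend :: "(nat \<Rightarrow> nat) \<Rightarrow> nat set \<Rightarrow> nat set \<Rightarrow> nat \<Rightarrow> nat" where
  "extend \<sigma> T A v = (if v \<in> T then \<sigma> v else v + Suc (\<Sum>A))"

lemma extend_same [simp]: "v \<in> T \<Longrightarrow> extend \<sigma> T A v = \<sigma> v"
  by (simp add: extend_def)

lemma extend_notin: "finite A \<Longrightarrow> v \<notin> T \<Longrightarrow> extend \<sigma> T A v \<notin> A"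
  using shift_fresh by (simp add: extend_def)

lemma inj_extend:
  assumes "finite A" "inj_on \<sigma> T" "\<sigma> ` T \<subseteq> A"
  shows "inj_on (extend \<sigma> T A) B"
proof (rule inj_onI)
  fix x y assume xy: "extend \<sigma> T A x = extend \<sigma> T A y"
  show "x = y"
  proof (cases "x \<in> T \<longleftrightarrow> y \<in> T")
    case True
    then show ?thesis using xy inj_onD[OF assms(2)] by (auto simp: extend_def split: if_splits)
  next
    case False
    then show ?thesis
      using xy extend_notin[OF assms(1), of x T \<sigma>] extend_notin[OF assms(1), of y T \<sigma>] assms(3)
      by (metis extend_same image_subset_iff)
  qed
qed

text \<open>A \<open>T\<close>-labeled graph becomes \<open>S\<close>-labeled through
  \<open>\<sigma>\<close>, with the labels of \<open>S\<close> that are not hit added as isolated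
  nodes. For \<open>\<sigma> = id\<close> this restricts a character to fewer labels.\<close>

definition pullback ::
  "(nat \<Rightarrow> nat) \<Rightarrow> nat set \<Rightarrow> nat set \<Rightarrow> (mgraph \<Rightarrow> 'a::field) \<Rightarrow> mgraph \<Rightarrow> 'a" where
  "pullback \<sigma> T S \<omega> G =
     (if G \<in> graphs_on T then \<omega> (gsum (edgeless S) (rename (extend \<sigma> T S) G)) else 0)"

text \<open>The fresh names chosen by \<open>extend\<close> are immaterial: any injective renaming
  that agrees with \<open>\<sigma>\<close> on the labels and sends the other nodes outside
  \<open>S\<close> gives an isomorphic \<open>S\<close>-labeled graph.\<close>

lemma pullback_eq:
  assumes \<omega>: "\<omega> \<in> chars S" and S: "finite S" and \<sigma>: "inj_on \<sigma> T" "\<sigma> ` T \<subseteq> S" and G: "G \<in> graphs_on T"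
    and \<tau>: "inj_on \<tau> (verts G)" "\<And>v. v \<in> T \<Longrightarrow> \<tau> v = \<sigma> v" "\<And>v. v \<in> verts G \<Longrightarrow> v \<notin> T \<Longrightarrow> \<tau> v \<notin> S"
  shows "pullback \<sigma> T S \<omega> G = \<omega> (gsum (edgeless S) (rename \<tau> G))"
proof -
  let ?e = "extend \<sigma> T S"
  let ?K = "gsum (edgeless S) (rename ?e G)"
  have G': "graph G" "T \<subseteq> verts G" using G by (auto simp: graphs_on_def)
  have K: "?K \<in> graphs_on S"
    using G' S by (auto simp: graphs_on_def intro!: graph_gsum graph_rename inj_extend[OF S \<sigma>])
  \<comment> \<open>Outside \<open>S\<close> this undoes the translation made by
    \<open>extend\<close> and then applies \<open>\<tau>\<close>.\<close>
  define \<rho> where "\<rho> w = (if w \<in> S then w else \<tau> (w - Suc (\<Sum>S)))" for w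
  have \<rho>e: "\<rho> (?e v) = \<tau> v" if "v \<in> verts G" for v
    using \<sigma>(2) \<tau>(2) extend_notin[OF S, of v T \<sigma>]
    by (cases "v \<in> T") (auto simp: \<rho>_def extend_def)
  have "inj_on \<rho> (verts ?K)"
  proof (rule inj_onI)
    fix x y assume xy: "x \<in> verts ?K" "y \<in> verts ?K" "\<rho> x = \<rho> y"
    have *: "z \<in> S \<or> (\<exists>v. v \<in> verts G \<and> v \<notin> T \<and> z = ?e v)" if "z \<in> verts ?K" for z
      using that \<sigma>(2) extend_same[of _ T \<sigma> S] by force
    have S: "\<rho> z = z" if "z \<in> S" for z using that by (simp add: \<rho>_def)
    from *[OF xy(1)] *[OF xy(2)] show "x = y"
    proof (elim disjE exE conjE)
      fix u v assume "u \<in> verts G" "v \<in> verts G" "x = ?e u" "y = ?e v"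
      then show ?thesis using xy(3) \<rho>e inj_onD[OF \<tau>(1)] by metis
    qed (use xy(3) \<rho>e \<tau>(3) S in metis)+
  qed
  then have "\<omega> (rename \<rho> ?K) = \<omega> ?K"
    by (intro chars_rename[OF \<omega> K]) (auto simp: \<rho>_def)
  moreover have "rename \<rho> ?K = gsum (edgeless S) (rename \<tau> G)"
  proof -
    have "rename (\<rho> \<circ> ?e) G = rename \<tau> G" using \<rho>e G' by (intro rename_cong) auto
    moreover have "\<rho> ` S = S" by (auto simp: \<rho>_def)
    ultimately show ?thesis by (simp add: rename_gsum rename_comp)
  qed
  ultimately show ?thesis using G by (simp add: pullback_def)
qed

lemma pullback_inclusion:
  assumes "\<omega> \<in> chars S" "finite S" "T \<subseteq> S" "G \<in> graphs_on T" "verts G \<inter> S \<subseteq> T"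
  shows "pullback id T S \<omega> G = \<omega> (gsum (edgeless S) G)"
proof -
  have "pullback id T S \<omega> G = \<omega> (gsum (edgeless S) (rename id G))"
    by (rule pullback_eq) (use assms in auto)
  moreover have "rename id G = G" by (rule rename_id) (use assms in \<open>auto simp: graphs_on_def\<close>)
  ultimately show ?thesis by simp
qed

lemma pullback_cong:
  assumes "\<And>v. v \<in> T \<Longrightarrow> \<sigma> v = \<tau> v"
  shows "pullback \<sigma> T S \<omega> = pullback \<tau> T S \<omega>"
proof -
  have "extend \<sigma> T S = extend \<tau> T S" using assms by (auto simp: extend_def)
  then show ?thesis unfolding pullback_def by presburger
qed

lemma pullback_id:
  assumes "\<omega> \<in> chars S" "finite S"
  shows "pullback id S S \<omega> = \<omega>"
proof
  fix G show "pullback id S S \<omega> G = \<omega> G"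
  proof (cases "G \<in> graphs_on S")
    case True
    then have "gsum (edgeless S) G = G" by (simp add: gsum_commute gsum_edgeless graphs_on_def)
    then show ?thesis using pullback_inclusion[OF assms _ True] by simp
  next
    case False
    then show ?thesis using chars_outside[OF assms(1)] by (simp add: pullback_def)
  qed
qed

lemma extended_graphs_on:
  assumes "finite S" "inj_on \<sigma> T" "\<sigma> ` T \<subseteq> S" "graph G"
  shows "gsum (edgeless S) (rename (extend \<sigma> T S) G) \<in> graphs_on S"
  using assms by (auto simp: graphs_on_def intro!: graph_gsum graph_rename inj_extend)

text \<open>The added labels are shared by both factors, so adding them commutes with
  gluing.\<close>

lemma pullback_chars:
  assumes \<omega>: "\<omega> \<in> chars S" and S: "finite S" and \<sigma>: "inj_on \<sigma> T" "\<sigma> ` T \<subseteq> S"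
  shows "pullback \<sigma> T S \<omega> \<in> chars T"
  unfolding chars_def mem_Collect_eq
proof (intro conjI allI ballI impI)
  let ?e = "extend \<sigma> T S"
  have T: "finite T" using S \<sigma> finite_imageD finite_subset by metis
  show "pullback \<sigma> T S \<omega> G = 0" if "G \<notin> graphs_on T" for G using that by (simp add: pullback_def)
  show "pullback \<sigma> T S \<omega> (edgeless T) = 1"
    using \<sigma>(2) chars_edgeless[OF \<omega>] edgeless_graphs_on[OF T] gsum_edgeless[of "?e ` T" "edgeless S"]
    by (simp add: pullback_def)
  show "pullback \<sigma> T S \<omega> (rename \<tau> G) = pullback \<sigma> T S \<omega> G"
    if G: "G \<in> graphs_on T" and \<tau>: "inj_on \<tau> (verts G) \<and> (\<forall>v\<in>T. \<tau> v = v)" for G \<tau>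
  proof -
    have G': "T \<subseteq> verts G" using G by (auto simp: graphs_on_def)
    have "rename \<tau> G \<in> graphs_on T" using G \<tau> by (force simp: graphs_on_def)
    then have "pullback \<sigma> T S \<omega> (rename \<tau> G) = \<omega> (gsum (edgeless S) (rename (?e \<circ> \<tau>) G))"
      by (simp add: pullback_def rename_comp)
    also have "\<dots> = pullback \<sigma> T S \<omega> G"
    proof (rule pullback_eq[symmetric, OF \<omega> S \<sigma> G])
      show "inj_on (?e \<circ> \<tau>) (verts G)" using \<tau> inj_extend[OF S \<sigma>] by (auto intro: comp_inj_on)
      show "(?e \<circ> \<tau>) v \<notin> S" if "v \<in> verts G" "v \<notin> T" for v
      proof -
        have "\<tau> v \<notin> T" using that \<tau> G' by (metis inj_onD subsetD)
        then show ?thesis using extend_notin[OF S] by simp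
      qed
    qed (use \<tau> in auto)
    finally show ?thesis .
  qed
  show "pullback \<sigma> T S \<omega> (gsum G H) = pullback \<sigma> T S \<omega> G * pullback \<sigma> T S \<omega> H"
    if G: "G \<in> graphs_on T" "H \<in> graphs_on T" "verts G \<inter> verts H = T" for G H
  proof -
    have gr: "graph G" "graph H" using G by (auto simp: graphs_on_def)
    have GH: "gsum G H \<in> graphs_on T" using gsum_graphs_on[OF G(1,2)] by simp
    have e: "?e ` verts G \<inter> ?e ` verts H \<subseteq> S"
      using inj_on_image_Int[OF inj_extend[OF S \<sigma>, of UNIV], of "verts G" "verts H"] G(3) \<sigma>(2) by auto
    have "gsum (edgeless S) (rename ?e (gsum G H)) =
        gsum (gsum (edgeless S) (rename ?e G)) (gsum (edgeless S) (rename ?e H))"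
      by (rule mgraph_eqI) auto
    moreover have "\<omega> \<dots> = \<omega> (gsum (edgeless S) (rename ?e G)) * \<omega> (gsum (edgeless S) (rename ?e H))"
      by (rule chars_gsum[OF \<omega>]) (use extended_graphs_on[OF S \<sigma>] gr e in auto)
    ultimately show ?thesis using G GH by (simp add: pullback_def)
  qed
qed

text \<open>Contravariant functoriality. Adding first the labels \<open>T\<close> and then the
  labels \<open>S\<close> amounts to adding \<open>S\<close>, because \<open>\<sigma>\<close> maps
  \<open>T\<close> into \<open>S\<close>; the composed renaming is admissible in
  \<open>pullback_eq\<close>.\<close>

lemma pullback_comp:
  assumes \<omega>: "\<omega> \<in> chars S" and S: "finite S" and \<sigma>: "inj_on \<sigma> T" "\<sigma> ` T \<subseteq> S"
    and \<tau>: "inj_on \<tau> R" "\<tau> ` R \<subseteq> T"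
  shows "pullback \<tau> R T (pullback \<sigma> T S \<omega>) = pullback (\<sigma> \<circ> \<tau>) R S \<omega>"
proof
  fix G
  have T: "finite T" using S \<sigma> finite_imageD finite_subset by metis
  show "pullback \<tau> R T (pullback \<sigma> T S \<omega>) G = pullback (\<sigma> \<circ> \<tau>) R S \<omega> G"
  proof (cases "G \<in> graphs_on R")
    case G: True
    let ?K = "gsum (edgeless T) (rename (extend \<tau> R T) G)"
    have K: "?K \<in> graphs_on T"
      using extended_graphs_on[OF T \<tau>] G by (auto simp: graphs_on_def)
    have "pullback \<tau> R T (pullback \<sigma> T S \<omega>) G = pullback \<sigma> T S \<omega> ?K"
      using G by (simp add: pullback_def)
    also have "\<dots> = \<omega> (gsum (edgeless S) (rename (extend \<sigma> T S) ?K))"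
      using K by (simp add: pullback_def)
    also have "gsum (edgeless S) (rename (extend \<sigma> T S) ?K) =
        gsum (edgeless S) (rename (extend \<sigma> T S \<circ> extend \<tau> R T) G)"
      using \<sigma>(2) by (intro mgraph_eqI) (auto simp: rename_comp rename_gsum image_comp)
    also have "\<omega> \<dots> = pullback (\<sigma> \<circ> \<tau>) R S \<omega> G"
    proof (rule pullback_eq[symmetric, OF \<omega> S _ _ G])
      show "inj_on (\<sigma> \<circ> \<tau>) R" using \<sigma> \<tau> by (meson comp_inj_on inj_on_subset)
      show "inj_on (extend \<sigma> T S \<circ> extend \<tau> R T) (verts G)"
        by (intro comp_inj_on inj_extend S T \<sigma> \<tau>)
      show "(extend \<sigma> T S \<circ> extend \<tau> R T) v \<notin> S" if "v \<notin> R" for v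
        using extend_notin[OF S extend_notin[OF T that]] by simp
    qed (use \<sigma> \<tau> in auto)
    finally show ?thesis .
  qed (simp add: pullback_def)
qed

section \<open>Characters of a fixed parameter: pullback and weights\<close>

locale character_system =
  fixes f :: "mgraph \<Rightarrow> 'a::field" and q :: nat
    and X :: "nat set \<Rightarrow> (mgraph \<Rightarrow> 'a) set" and lam :: "nat set \<Rightarrow> (mgraph \<Rightarrow> 'a) \<Rightarrow> 'a"
  assumes f_rename: "graph G \<Longrightarrow> inj_on \<tau> (verts G) \<Longrightarrow> f (rename \<tau> G) = f G"
    and f_empty: "f (edgeless {}) = 1"
    and finite_X: "finite S \<Longrightarrow> finite (X S)"
    and card_X: "finite S \<Longrightarrow> card (X S) \<le> q ^ card S"
    and X_chars: "finite S \<Longrightarrow> \<chi> \<in> X S \<Longrightarrow> \<chi> \<in> chars S"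
    and lam_nonzero: "finite S \<Longrightarrow> \<chi> \<in> X S \<Longrightarrow> lam S \<chi> \<noteq> 0"
    and f_eq: "finite S \<Longrightarrow> G \<in> graphs_on S \<Longrightarrow> f G = (\<Sum>\<chi>\<in>X S. lam S \<chi> * \<chi> G)"
begin

text \<open>Glue \<open>G\<close> to a copy of a test graph \<open>H\<close> along the image of
  \<open>\<sigma>\<close> and compute \<open>f\<close> twice: as an \<open>S\<close>-labeled graph,
  where \<open>\<omega>\<close> sees \<open>H\<close> through its pullback, and, after renaming the
  labels back, as a \<open>T\<close>-labeled graph. The claim compares coefficients of these two
  functions of \<open>H\<close>.\<close>

lemma pullback_sum:
  assumes S: "finite S" and \<sigma>: "inj_on \<sigma> T" "\<sigma> ` T \<subseteq> S" and G: "G \<in> graphs_on S"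
  shows "(\<Sum>\<omega> | \<omega> \<in> X S \<and> pullback \<sigma> T S \<omega> = \<theta>. lam S \<omega> * \<omega> G)
    = (if \<theta> \<in> X T then lam T \<theta> * \<theta> (rename (extend (inv_into T \<sigma>) (\<sigma> ` T) T) G) else 0)"
proof -
  have T: "finite T" using S \<sigma> finite_imageD finite_subset by metis
  \<comment> \<open>This sends the label \<open>\<sigma> v\<close> back to \<open>v\<close> and all
    nodes outside the image of \<open>\<sigma>\<close> away from \<open>T\<close>.\<close>
  define \<rho> where "\<rho> = extend (inv_into T \<sigma>) (\<sigma> ` T) T"
  have \<rho>: "inj_on \<rho> A" for A
    unfolding \<rho>_def using \<sigma>(1) by (intro inj_extend T inj_on_inv_into) auto
  have \<rho>\<sigma>: "\<rho> (\<sigma> v) = v" if "v \<in> T" for v using that \<sigma>(1) by (simp add: \<rho>_def)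
  have G': "graph G" "S \<subseteq> verts G" "finite (verts G)" using G by (auto simp: graphs_on_def graph_def)
  have \<rho>G: "rename \<rho> G \<in> graphs_on T"
  proof -
    have "T \<subseteq> \<rho> ` verts G" using \<rho>\<sigma> \<sigma>(2) G'(2) by (force simp: image_iff)
    then show ?thesis using graph_rename[OF G'(1) \<rho>] by (simp add: graphs_on_def)
  qed
  have "(\<Sum>\<omega>\<in>X S. (lam S \<omega> * \<omega> G) * pullback \<sigma> T S \<omega> H)
      = (\<Sum>\<chi>\<in>X T. (lam T \<chi> * \<chi> (rename \<rho> G)) * \<chi> H)" if H: "H \<in> graphs_on T" for H
  proof -
    \<comment> \<open>\<open>H\<close> is placed so that it meets \<open>G\<close>, and with it the
      label set \<open>S\<close>, in the image of \<open>\<sigma>\<close> only.\<close>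
    define \<tau> where "\<tau> = extend \<sigma> T (verts G)"
    let ?H = "rename \<tau> H"
    have H': "graph H" "T \<subseteq> verts H" using H by (auto simp: graphs_on_def)
    have \<sigma>G: "\<sigma> ` T \<subseteq> verts G" using \<sigma>(2) G'(2) by blast
    have \<tau>: "inj_on \<tau> A" for A unfolding \<tau>_def by (rule inj_extend[OF G'(3) \<sigma>(1) \<sigma>G])
    have \<tau>T: "\<tau> v = \<sigma> v" if "v \<in> T" for v using that by (simp add: \<tau>_def)
    have \<tau>n: "\<tau> v \<notin> verts G" if "v \<notin> T" for v using extend_notin[OF G'(3) that] by (simp add: \<tau>_def)
    have int: "verts G \<inter> \<tau> ` verts H = \<sigma> ` T"
    proof (intro equalityI subsetI)
      fix w assume "w \<in> verts G \<inter> \<tau> ` verts H"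
      then obtain v where "w = \<tau> v" "\<tau> v \<in> verts G" by auto
      then show "w \<in> \<sigma> ` T" using \<tau>n \<tau>T by (cases "v \<in> T") auto
    next
      fix w assume "w \<in> \<sigma> ` T"
      then obtain v where "v \<in> T" "w = \<tau> v" using \<tau>T by force
      then show "w \<in> verts G \<inter> \<tau> ` verts H" using \<tau>T[of v] \<sigma>G H'(2) by (simp add: image_subset_iff) (metis imageI subsetD)
    qed
    let ?K = "gsum G ?H"
    have gH: "graph ?H" using graph_rename[OF H'(1) \<tau>] .
    have gK: "graph ?K" using graph_gsum[OF G'(1) gH] .
    have KS: "?K \<in> graphs_on S" using gK G' by (auto simp: graphs_on_def)
    have "f ?K = (\<Sum>\<omega>\<in>X S. (lam S \<omega> * \<omega> G) * pullback \<sigma> T S \<omega> H)"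
      unfolding f_eq[OF S KS]
    proof (rule sum.cong)
      fix \<omega> assume "\<omega> \<in> X S"
      then have \<omega>: "\<omega> \<in> chars S" using X_chars S by blast
      have "?K = gsum G (gsum (edgeless S) ?H)" using G' by (intro mgraph_eqI) auto
      moreover have "\<omega> \<dots> = \<omega> G * \<omega> (gsum (edgeless S) ?H)"
      proof (rule chars_gsum[OF \<omega> G])
        show "gsum (edgeless S) ?H \<in> graphs_on S" using S gH by (auto simp: graphs_on_def)
        show "verts G \<inter> verts (gsum (edgeless S) ?H) = S" using int G' \<sigma> by auto
      qed
      moreover have "\<omega> (gsum (edgeless S) ?H) = pullback \<sigma> T S \<omega> H"
        by (rule pullback_eq[OF \<omega> S \<sigma> H, symmetric]) (use \<tau> \<tau>T \<tau>n G' in auto)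
      ultimately show "lam S \<omega> * \<omega> ?K = lam S \<omega> * \<omega> G * pullback \<sigma> T S \<omega> H" by simp
    qed simp
    moreover have "f ?K = (\<Sum>\<chi>\<in>X T. (lam T \<chi> * \<chi> (rename \<rho> G)) * \<chi> H)"
    proof -
      have K: "rename \<rho> ?K = gsum (rename \<rho> G) (rename (\<rho> \<circ> \<tau>) H)"
        by (simp add: rename_gsum rename_comp)
      have \<rho>\<tau>: "inj_on (\<rho> \<circ> \<tau>) A" for A using \<rho> \<tau> by (auto intro: comp_inj_on)
      have \<rho>\<tau>T: "(\<rho> \<circ> \<tau>) v = v" if "v \<in> T" for v using that \<tau>T \<rho>\<sigma> by simp
      have H2: "rename (\<rho> \<circ> \<tau>) H \<in> graphs_on T"
      proof -
        have "T \<subseteq> (\<rho> \<circ> \<tau>) ` verts H" using \<rho>\<tau>T H'(2) by (force simp: image_iff)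
        then show ?thesis using graph_rename[OF H'(1) \<rho>\<tau>] by (simp add: graphs_on_def)
      qed
      have "\<rho> ` verts G \<inter> \<rho> ` \<tau> ` verts H = \<rho> ` \<sigma> ` T"
        using inj_on_image_Int[OF \<rho>[of UNIV], of "verts G" "\<tau> ` verts H"] int by simp
      also have "\<dots> = T" using \<rho>\<sigma> by (force simp: image_comp)
      finally have int2: "verts (rename \<rho> G) \<inter> verts (rename (\<rho> \<circ> \<tau>) H) = T"
        by (simp add: image_comp)
      have "f ?K = f (rename \<rho> ?K)" using f_rename[OF gK \<rho>] by simp
      also have "\<dots> = (\<Sum>\<chi>\<in>X T. lam T \<chi> * \<chi> (rename \<rho> ?K))"
        unfolding K using gsum_graphs_on[OF \<rho>G H2] by (intro f_eq T) auto
      also have "\<dots> = (\<Sum>\<chi>\<in>X T. (lam T \<chi> * \<chi> (rename \<rho> G)) * \<chi> H)"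
      proof (rule sum.cong)
        fix \<chi> assume "\<chi> \<in> X T"
        then have \<chi>: "\<chi> \<in> chars T" using X_chars T by blast
        show "lam T \<chi> * \<chi> (rename \<rho> ?K) = lam T \<chi> * \<chi> (rename \<rho> G) * \<chi> H"
          unfolding K chars_gsum[OF \<chi> \<rho>G H2 int2] using chars_rename[OF \<chi> H, of "\<rho> \<circ> \<tau>", OF \<rho>\<tau> \<rho>\<tau>T] by simp
      qed simp
      finally show ?thesis .
    qed
    ultimately show ?thesis by simp
  qed
  then have "(\<Sum>\<omega> | \<omega> \<in> X S \<and> pullback \<sigma> T S \<omega> = \<theta>. lam S \<omega> * \<omega> G)
      = (if \<theta> \<in> X T then lam T \<theta> * \<theta> (rename \<rho> G) else 0)"
    by (intro chars_coeff_eq[OF T]) (use finite_X S T X_chars pullback_chars[OF X_chars[OF S] S \<sigma>] in auto)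
  then show ?thesis by (simp add: \<rho>_def)
qed

text \<open>Otherwise \<open>pullback_sum\<close> makes the part of the expansion lying over this
  pullback a vanishing combination of characters with nonzero coefficients.\<close>

lemma pullback_X:
  assumes S: "finite S" and \<sigma>: "inj_on \<sigma> T" "\<sigma> ` T \<subseteq> S" and \<omega>: "\<omega> \<in> X S"
  shows "pullback \<sigma> T S \<omega> \<in> X T"
proof (rule ccontr)
  assume n: "pullback \<sigma> T S \<omega> \<notin> X T"
  have "lam S \<omega> = 0"
  proof (rule chars_independent[OF S, where c = "lam S"])
    show "finite {\<omega>' \<in> X S. pullback \<sigma> T S \<omega>' = pullback \<sigma> T S \<omega>}" using finite_X[OF S] by simp
    show "(\<Sum>\<omega>'\<in>{\<omega>' \<in> X S. pullback \<sigma> T S \<omega>' = pullback \<sigma> T S \<omega>}. lam S \<omega>' * \<omega>' G) = 0"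
      if "G \<in> graphs_on S" for G
      using pullback_sum[OF S \<sigma> that, of "pullback \<sigma> T S \<omega>"] n by simp
  qed (use \<omega> X_chars[OF S] in auto)
  then show False using lam_nonzero[OF S \<omega>] by simp
qed

text \<open>The case of an inclusion in \<open>pullback_sum\<close>: read on graphs that carry all
  the labels of \<open>S\<close>, a character on \<open>T\<close> expands over its extensions to
  \<open>S\<close>.\<close>

lemma restriction_sum:
  assumes S: "finite S" and T: "T \<subseteq> S" and G: "G \<in> graphs_on S" and \<theta>: "\<theta> \<in> X T"
  shows "lam T \<theta> * \<theta> G = (\<Sum>\<omega> | \<omega> \<in> X S \<and> pullback id T S \<omega> = \<theta>. lam S \<omega> * \<omega> G)"
proof -
  have finT: "finite T" using T S finite_subset by blast
  have inv: "inv_into T id v = v" if "v \<in> T" for v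
    using that by (metis id_apply inj_on_id inv_into_f_f)
  have "\<theta> (rename (extend (inv_into T id) (id ` T) T) G) = \<theta> G"
  proof (rule chars_rename[OF X_chars[OF finT \<theta>]])
    show "G \<in> graphs_on T" using G T by (auto simp: graphs_on_def)
    show "inj_on (extend (inv_into T id) (id ` T) T) (verts G)"
      by (intro inj_extend finT inj_on_inv_into) (use inv in auto)
  qed (use inv in auto)
  then show ?thesis using pullback_sum[OF S inj_on_id, of T G \<theta>] T G \<theta> by simp
qed

text \<open>Pullback along a bijection is invertible, so the fibre over the pulled back character is
  the single \<open>\<omega>\<close>. At the edgeless graph, where characters equal 1,
  \<open>pullback_sum\<close> then compares the two weights.\<close>

lemma lam_pullback_bij:
  assumes S: "finite S" and \<sigma>: "bij_betw \<sigma> T S" and \<omega>: "\<omega> \<in> X S"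
  shows "lam T (pullback \<sigma> T S \<omega>) = lam S \<omega>"
proof -
  let ?\<theta> = "pullback \<sigma> T S \<omega>"
  have inj: "inj_on \<sigma> T" and im: "\<sigma> ` T = S" using \<sigma> by (auto simp: bij_betw_def)
  have T: "finite T" using S \<sigma> bij_betw_finite by blast
  let ?\<rho> = "inv_into T \<sigma>"
  have \<rho>: "inj_on ?\<rho> S" "?\<rho> ` S \<subseteq> T" using im by (auto intro: inj_on_inv_into inv_into_into)
  have inv: "pullback ?\<rho> S T (pullback \<sigma> T S \<omega>') = \<omega>'" if "\<omega>' \<in> X S" for \<omega>'
  proof -
    have c: "\<omega>' \<in> chars S" using X_chars[OF S that] .
    have "pullback ?\<rho> S T (pullback \<sigma> T S \<omega>') = pullback (\<sigma> \<circ> ?\<rho>) S S \<omega>'"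
      by (rule pullback_comp[OF c S inj _ \<rho>]) (use im in auto)
    also have "\<dots> = pullback id S S \<omega>'"
      by (rule pullback_cong) (use im in \<open>auto simp: f_inv_into_f\<close>)
    finally show ?thesis using pullback_id[OF c S] by simp
  qed
  have "{\<omega>'. \<omega>' \<in> X S \<and> pullback \<sigma> T S \<omega>' = ?\<theta>} = {\<omega>}" using inv \<omega> by (auto) (metis inv)
  moreover have "?\<theta> \<in> X T" using pullback_X[OF S inj _ \<omega>] im by simp
  moreover have "extend ?\<rho> (\<sigma> ` T) T ` S = T"
  proof -
    have "extend ?\<rho> (\<sigma> ` T) T ` S = ?\<rho> ` S" using im by (intro image_cong) auto
    then show ?thesis using inv_into_image_cancel[OF inj, of T] im by simp
  qed
  ultimately show ?thesis
    using pullback_sum[OF S inj _ edgeless_graphs_on[OF S], of ?\<theta>] im chars_edgeless[OF X_chars[OF S \<omega>]]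
      chars_edgeless[OF X_chars[OF T], of ?\<theta>] by simp
qed

section \<open>Amalgamation\<close>

text \<open>Both sides are \<open>f\<close> of one graph, glued from copies of \<open>G1\<close> and
  \<open>G2\<close> along \<open>T1 \<inter> T2\<close>: on the left expanded with all labels of
  \<open>T1 \<union> T2\<close>, on the right with the common labels only.\<close>

lemma amalgamation_identity:
  assumes T1: "finite T1" and T2: "finite T2"
    and G1: "G1 \<in> graphs_on T1" and G2: "G2 \<in> graphs_on T2"
  shows "(\<Sum>\<omega>\<in>X (T1 \<union> T2). lam (T1 \<union> T2) \<omega> *
      pullback id T1 (T1 \<union> T2) \<omega> G1 * pullback id T2 (T1 \<union> T2) \<omega> G2)
    = (\<Sum>\<chi>\<in>X (T1 \<inter> T2). lam (T1 \<inter> T2) \<chi> * \<chi> G1 * \<chi> G2)"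
proof -
  let ?T = "T1 \<union> T2" and ?S = "T1 \<inter> T2"
  have T: "finite ?T" and S: "finite ?S" using T1 T2 by auto
  define H1 where "H1 = rename (shift T1 ?T) G1"
  have H1: "H1 \<in> graphs_on T1" "verts H1 \<inter> ?T = T1"
    unfolding H1_def using graph_rename_shift[OF G1 T] by auto
  \<comment> \<open>The nodes of the first copy are included so that the second copy meets it in
    \<open>T1 \<inter> T2\<close> only.\<close>
  define A where "A = ?T \<union> verts H1"
  have A: "finite A" "T2 \<subseteq> A" using T H1 by (auto simp: A_def graphs_on_def graph_def)
  define H2 where "H2 = rename (shift T2 A) G2"
  have H2: "H2 \<in> graphs_on T2" "verts H2 \<inter> A = T2"
    unfolding H2_def using graph_rename_shift[OF G2 A] by auto
  have sub: "T1 \<subseteq> verts H1" "T2 \<subseteq> verts H2" using H1(1) H2(1) by (auto simp: graphs_on_def)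
  have gr: "graph H1" "graph H2" using H1 H2 by (auto simp: graphs_on_def)
  let ?K = "gsum H1 H2"
  have KT: "?K \<in> graphs_on ?T" using gsum_graphs_on[OF H1(1) H2(1)] .
  have "f ?K = (\<Sum>\<omega>\<in>X ?T. lam ?T \<omega> * pullback id T1 ?T \<omega> G1 * pullback id T2 ?T \<omega> G2)"
    unfolding f_eq[OF T KT]
  proof (rule sum.cong)
    fix \<omega> assume "\<omega> \<in> X ?T"
    then have \<omega>: "\<omega> \<in> chars ?T" using X_chars T by blast
    have "?K = gsum (gsum (edgeless ?T) H1) (gsum (edgeless ?T) H2)"
      using sub by (intro mgraph_eqI) auto
    moreover have "\<omega> \<dots> = \<omega> (gsum (edgeless ?T) H1) * \<omega> (gsum (edgeless ?T) H2)"
      by (rule chars_gsum[OF \<omega>]) (use gr T H1 H2 in \<open>auto simp: graphs_on_def A_def\<close>)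
    moreover have "\<omega> (gsum (edgeless ?T) H1) = pullback id T1 ?T \<omega> H1"
      by (rule pullback_inclusion[OF \<omega> T _ H1(1), symmetric]) (use H1(2) in auto)
    moreover have "\<omega> (gsum (edgeless ?T) H2) = pullback id T2 ?T \<omega> H2"
      by (rule pullback_inclusion[OF \<omega> T _ H2(1), symmetric]) (use H2(2) in \<open>auto simp: A_def\<close>)
    moreover have "pullback id T1 ?T \<omega> H1 = pullback id T1 ?T \<omega> G1"
      unfolding H1_def by (rule chars_shift[OF pullback_chars[OF \<omega> T] G1 T]) auto
    moreover have "pullback id T2 ?T \<omega> H2 = pullback id T2 ?T \<omega> G2"
      unfolding H2_def by (rule chars_shift[OF pullback_chars[OF \<omega> T] G2 A]) auto
    ultimately show "lam ?T \<omega> * \<omega> ?K = lam ?T \<omega> * pullback id T1 ?T \<omega> G1 * pullback id T2 ?T \<omega> G2"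
      by simp
  qed simp
  moreover have "f ?K = (\<Sum>\<chi>\<in>X ?S. lam ?S \<chi> * \<chi> G1 * \<chi> G2)"
  proof -
    have HS: "H1 \<in> graphs_on ?S" "H2 \<in> graphs_on ?S" "?K \<in> graphs_on ?S"
      "G1 \<in> graphs_on ?S" "G2 \<in> graphs_on ?S"
      using H1(1) H2(1) KT G1 G2 by (auto simp: graphs_on_def)
    have int: "verts H1 \<inter> verts H2 = ?S" using H1(2) H2(2) sub by (auto simp: A_def)
    show ?thesis unfolding f_eq[OF S HS(3)]
    proof (rule sum.cong)
      fix \<chi> assume "\<chi> \<in> X ?S"
      then have \<chi>: "\<chi> \<in> chars ?S" using X_chars S by blast
      have "\<chi> H1 = \<chi> G1" unfolding H1_def
        by (rule chars_rename[OF \<chi> HS(4)]) (use T inj_shift[of ?T T1] in auto)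
      moreover have "\<chi> H2 = \<chi> G2" unfolding H2_def
        by (rule chars_rename[OF \<chi> HS(5)]) (use A inj_shift[of A T2] in auto)
      ultimately show "lam ?S \<chi> * \<chi> ?K = lam ?S \<chi> * \<chi> G1 * \<chi> G2"
        unfolding chars_gsum[OF \<chi> HS(1,2) int] by simp
    qed simp
  qed
  ultimately show ?thesis by simp
qed

text \<open>Coefficients in \<open>amalgamation_identity\<close> are compared twice, first as
  functions of \<open>G2\<close> and then of \<open>G1\<close>. The right side is nonzero, so
  compatible \<open>\<omega>1\<close> and \<open>\<omega>2\<close> have a common extension; the
  formula gives the total weight of such extensions, not yet their number.\<close>

lemma amalgamation:
  assumes T1: "finite T1" and T2: "finite T2" and \<omega>1: "\<omega>1 \<in> X T1" and \<omega>2: "\<omega>2 \<in> X T2"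
    and eq: "pullback id (T1 \<inter> T2) T1 \<omega>1 = \<chi>" "pullback id (T1 \<inter> T2) T2 \<omega>2 = \<chi>"
  shows "(\<Sum>\<omega> | \<omega> \<in> X (T1 \<union> T2) \<and> pullback id T2 (T1 \<union> T2) \<omega> = \<omega>2 \<and> pullback id T1 (T1 \<union> T2) \<omega> = \<omega>1.
      lam (T1 \<union> T2) \<omega>) = lam T1 \<omega>1 * lam T2 \<omega>2 / lam (T1 \<inter> T2) \<chi>"
proof -
  let ?T = "T1 \<union> T2" and ?S = "T1 \<inter> T2"
  let ?r1 = "pullback id T1 ?T" and ?r2 = "pullback id T2 ?T" and ?s1 = "pullback id ?S T1" and ?s2 = "pullback id ?S T2"
  have T: "finite ?T" and S: "finite ?S" using T1 T2 by auto
  have \<chi>: "\<chi> \<in> X ?S" using pullback_X[OF T1 _ _ \<omega>1, of id ?S] eq by simp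
  have s2X: "?s2 ` X T2 \<subseteq> X ?S" using pullback_X[OF T2, of id ?S] by auto
  have r1: "?r1 \<omega> \<in> chars T1" and r2: "?r2 \<omega> \<in> chars T2" if "\<omega> \<in> X ?T" for \<omega>
    using pullback_chars[OF X_chars[OF T that] T, of id] by auto
  \<comment> \<open>This is the coefficient of \<open>\<omega>2\<close>, with \<open>G1\<close>
    fixed.\<close>
  have step: "(\<Sum>\<omega> | \<omega> \<in> X ?T \<and> ?r2 \<omega> = \<omega>2. lam ?T \<omega> * ?r1 \<omega> G1) = lam T2 \<omega>2 * \<chi> G1"
    if G1: "G1 \<in> graphs_on T1" for G1
  proof -
    have "(\<Sum>\<omega> | \<omega> \<in> X ?T \<and> ?r2 \<omega> = \<omega>2. lam ?T \<omega> * ?r1 \<omega> G1) =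
        (if \<omega>2 \<in> X T2 then lam T2 \<omega>2 * ?s2 \<omega>2 G1 else 0)"
    proof (rule chars_coeff_eq[OF T2])
      fix G2 assume G2: "G2 \<in> graphs_on T2"
      have "(\<Sum>\<omega>\<in>X ?T. lam ?T \<omega> * ?r1 \<omega> G1 * ?r2 \<omega> G2) = (\<Sum>\<chi>\<in>X ?S. lam ?S \<chi> * \<chi> G1 * \<chi> G2)"
        by (rule amalgamation_identity[OF T1 T2 G1 G2])
      also have "\<dots> = (\<Sum>\<chi>\<in>X ?S. \<Sum>\<omega> | \<omega> \<in> X T2 \<and> ?s2 \<omega> = \<chi>. lam T2 \<omega> * ?s2 \<omega> G1 * \<omega> G2)"
      proof (rule sum.cong)
        fix \<chi> assume \<chi>: "\<chi> \<in> X ?S"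
        have "lam ?S \<chi> * \<chi> G1 * \<chi> G2 = \<chi> G1 * (lam ?S \<chi> * \<chi> G2)" by simp
        also have "\<dots> = \<chi> G1 * (\<Sum>\<omega> | \<omega> \<in> X T2 \<and> ?s2 \<omega> = \<chi>. lam T2 \<omega> * \<omega> G2)"
          using restriction_sum[OF T2 _ G2 \<chi>] by simp
        also have "\<dots> = (\<Sum>\<omega> | \<omega> \<in> X T2 \<and> ?s2 \<omega> = \<chi>. lam T2 \<omega> * ?s2 \<omega> G1 * \<omega> G2)"
          unfolding sum_distrib_left by (intro sum.cong) auto
        finally show "lam ?S \<chi> * \<chi> G1 * \<chi> G2 = \<dots>" .
      qed simp
      also have "\<dots> = (\<Sum>\<omega>\<in>X T2. lam T2 \<omega> * ?s2 \<omega> G1 * \<omega> G2)"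
        by (rule sum.group) (use finite_X S T2 s2X in auto)
      finally show "(\<Sum>\<omega>\<in>X ?T. lam ?T \<omega> * ?r1 \<omega> G1 * ?r2 \<omega> G2) = \<dots>" .
    qed (use finite_X T T2 r2 X_chars in auto)
    then show ?thesis using eq \<omega>2 by simp
  qed
  \<comment> \<open>This is the coefficient of \<open>\<omega>1\<close>, after expanding
    \<open>\<chi>\<close> over its extensions to \<open>T1\<close>.\<close>
  have "(\<Sum>\<omega> | \<omega> \<in> {\<omega>. \<omega> \<in> X ?T \<and> ?r2 \<omega> = \<omega>2} \<and> ?r1 \<omega> = \<omega>1. lam ?T \<omega>) =
      (if \<omega>1 \<in> {\<omega>. \<omega> \<in> X T1 \<and> ?s1 \<omega> = \<chi>} then lam T2 \<omega>2 / lam ?S \<chi> * lam T1 \<omega>1 else 0)"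
  proof (rule chars_coeff_eq[OF T1])
    fix G1 assume G1: "G1 \<in> graphs_on T1"
    have "(\<Sum>\<omega> | \<omega> \<in> X ?T \<and> ?r2 \<omega> = \<omega>2. lam ?T \<omega> * ?r1 \<omega> G1) = lam T2 \<omega>2 / lam ?S \<chi> * (lam ?S \<chi> * \<chi> G1)"
      unfolding step[OF G1] using lam_nonzero[OF S \<chi>] by simp
    also have "\<dots> = lam T2 \<omega>2 / lam ?S \<chi> * (\<Sum>\<omega> | \<omega> \<in> X T1 \<and> ?s1 \<omega> = \<chi>. lam T1 \<omega> * \<omega> G1)"
      using restriction_sum[OF T1 _ G1 \<chi>] by simp
    finally show "(\<Sum>\<omega> | \<omega> \<in> X ?T \<and> ?r2 \<omega> = \<omega>2. lam ?T \<omega> * ?r1 \<omega> G1) =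
        (\<Sum>\<omega> | \<omega> \<in> X T1 \<and> ?s1 \<omega> = \<chi>. lam T2 \<omega>2 / lam ?S \<chi> * lam T1 \<omega> * \<omega> G1)"
      by (simp add: sum_distrib_left mult.assoc)
  qed (use finite_X T T1 r1 X_chars in auto)
  then show ?thesis using \<omega>1 eq by (simp add: conj_assoc mult.commute)
qed

end

section \<open>Extensions of a character\<close>

text \<open>If \<open>d \<ge> q + 1\<close>, then \<open>d ^ m\<close> outgrows every constant
  multiple of \<open>q ^ m\<close>, by a Bernoulli estimate cleared of denominators.\<close>

lemma le_of_powers_le:
  fixes d q k :: nat
  assumes "\<And>m. d ^ m \<le> q ^ (k + m)"
  shows "d \<le> q"
proof (rule ccontr)
  assume "\<not> d \<le> q"
  then have d: "q + 1 \<le> d" by simp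
  have bernoulli: "(q + m) * q ^ m \<le> q * (q + 1) ^ m" for m
  proof (induction m)
    case (Suc m)
    have "(q + Suc m) * q ^ Suc m \<le> (q + 1) * ((q + m) * q ^ m)" by (simp add: algebra_simps)
    also have "\<dots> \<le> (q + 1) * (q * (q + 1) ^ m)" using Suc by (rule mult_left_mono) simp
    finally show ?case by (simp add: algebra_simps)
  qed simp
  show False
  proof (cases "q = 0")
    case True
    then show ?thesis using assms[of 1] d by simp
  next
    case False
    \<comment> \<open>With this \<open>m\<close> the bound \<open>q * q ^ (k + m)\<close> equals
      \<open>m * q ^ m\<close>, which is strictly below \<open>(q + m) * q ^ m\<close>.\<close>
    define m where "m = q ^ Suc k"
    have "(q + m) * q ^ m \<le> q * d ^ m"
      using bernoulli[of m] power_mono[OF d, of m] by (meson le_trans mult_le_mono2 zero_le)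
    also have "\<dots> \<le> q * q ^ (k + m)" using assms[of m] by simp
    also have "\<dots> = m * q ^ m" by (simp add: m_def power_add)
    finally show False using False by simp
  qed
qed

lemma restrict_eq_PiE_iff:
  assumes "\<phi> \<in> W \<rightarrow>\<^sub>E P"
  shows "restrict c W = \<phi> \<longleftrightarrow> (\<forall>v\<in>W. c v = \<phi> v)"
proof
  assume "\<forall>v\<in>W. c v = \<phi> v"
  then have "restrict c W = restrict \<phi> W" by (intro restrict_ext) simp
  then show "restrict c W = \<phi>" using PiE_restrict[OF assms] by simp
qed auto

text \<open>The base \<open>S\<close>, \<open>\<chi>\<close> is an argument because maximality
  compares different base characters.\<close>

definition extensions ::
  "(nat set \<Rightarrow> (mgraph \<Rightarrow> 'a::field) set) \<Rightarrow> nat set \<Rightarrow> (mgraph \<Rightarrow> 'a) \<Rightarrow> nat set \<Rightarrow> (mgraph \<Rightarrow> 'a) set" where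
  "extensions X S \<chi> W = {\<omega> \<in> X (S \<union> W). pullback id S (S \<union> W) \<omega> = \<chi>}"

locale based_character_system = character_system f q X lam
  for f :: "mgraph \<Rightarrow> 'a::field" and q X lam +
  fixes S :: "nat set" and \<chi> :: "mgraph \<Rightarrow> 'a" and a :: nat
  assumes S: "finite S" and \<chi>: "\<chi> \<in> X S" and a: "a \<notin> S"
begin

text \<open>Moving the label \<open>v\<close> to the fixed label \<open>a\<close> places the
  one-label restrictions at all \<open>v\<close> in one set, \<open>points\<close>, which becomes
  the node set of the target.\<close>

definition coord :: "nat set \<Rightarrow> (mgraph \<Rightarrow> 'a) \<Rightarrow> nat \<Rightarrow> mgraph \<Rightarrow> 'a" where
  "coord W \<omega> v = pullback (id(a := v)) (S \<union> {a}) (S \<union> W) \<omega>"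

abbreviation "points \<equiv> extensions X S \<chi> {a}"

lemma coord_points:
  assumes W: "finite W" "W \<inter> S = {}" and \<omega>: "\<omega> \<in> extensions X S \<chi> W" and v: "v \<in> W"
  shows "coord W \<omega> v \<in> points"
proof -
  have \<omega>X: "\<omega> \<in> X (S \<union> W)" and res: "pullback id S (S \<union> W) \<omega> = \<chi>"
    using \<omega> by (auto simp: extensions_def)
  have T: "finite (S \<union> W)" using S W by simp
  have inj: "inj_on (id(a := v)) (S \<union> {a})" and sub: "(id(a := v)) ` (S \<union> {a}) \<subseteq> S \<union> W"
    using a v W by (auto simp: inj_on_def)
  have "pullback id S (S \<union> {a}) (coord W \<omega> v) = pullback (id(a := v) \<circ> id) S (S \<union> W) \<omega>"
    unfolding coord_def by (rule pullback_comp[OF X_chars[OF T \<omega>X] T inj sub]) auto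
  also have "\<dots> = \<chi>" unfolding res[symmetric] by (rule pullback_cong) (use a in auto)
  finally show ?thesis
    using pullback_X[OF T inj sub \<omega>X] by (simp add: extensions_def coord_def)
qed

text \<open>Induction on \<open>W\<close>: an extension to \<open>insert v W\<close> restricts to
  one on \<open>W\<close> and to a one-label extension at \<open>v\<close>, and
  \<open>amalgamation\<close> gives the total weight of those with both restrictions prescribed. The
  sum on the left allows for several extensions with equal coordinates; maximality excludes this
  only later.\<close>

lemma weight_sum:
  assumes "finite W" "W \<inter> S = {}" "\<forall>v\<in>W. \<phi> v \<in> points"
  shows "(\<Sum>\<omega> | \<omega> \<in> extensions X S \<chi> W \<and> (\<forall>v\<in>W. coord W \<omega> v = \<phi> v). lam (S \<union> W) \<omega>)
    = lam S \<chi> * (\<Prod>v\<in>W. lam (S \<union> {a}) (\<phi> v) / lam S \<chi>)"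
  using assms
proof (induction W rule: finite_induct)
  case empty
  have "{\<omega>. \<omega> \<in> extensions X S \<chi> {} \<and> (\<forall>v\<in>{}. coord {} \<omega> v = \<phi> v)} = {\<chi>}"
    using \<chi> X_chars[OF S] pullback_id[OF _ S] by (auto simp: extensions_def)
  then show ?case by simp
next
  case (insert v W)
  let ?T1 = "S \<union> W" and ?T2 = "S \<union> {v}" and ?T = "S \<union> insert v W"
  let ?r1 = "pullback id ?T1 ?T" and ?r2 = "pullback id ?T2 ?T"
  have T: "?T1 \<union> ?T2 = ?T" "?T1 \<inter> ?T2 = S" using insert by auto
  have fin: "finite ?T1" "finite ?T2" "finite ?T" using S insert.hyps by auto
  have v: "v \<notin> S" "\<phi> v \<in> points" using insert.prems by auto
  then have \<phi>X: "\<phi> v \<in> X (S \<union> {a})" and \<phi>\<chi>: "pullback id S (S \<union> {a}) (\<phi> v) = \<chi>"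
    by (auto simp: extensions_def)
  have fa: "finite (S \<union> {a})" using S by simp
  have bij: "bij_betw (id(v := a)) ?T2 (S \<union> {a})"
    using v a by (auto simp: bij_betw_def inj_on_def)
  then have inj: "inj_on (id(v := a)) ?T2" and im: "(id(v := a)) ` ?T2 \<subseteq> S \<union> {a}"
    by (auto simp: bij_betw_def)
  have inj': "inj_on (id(a := v)) (S \<union> {a})" using v a by (auto simp: inj_on_def)
  \<comment> \<open>The point \<open>\<phi> v\<close> lives on the model label \<open>a\<close>;
    this is its copy on the label \<open>v\<close>.\<close>
  define \<psi> where "\<psi> = pullback (id(v := a)) ?T2 (S \<union> {a}) (\<phi> v)"
  have \<psi>X: "\<psi> \<in> X ?T2" unfolding \<psi>_def by (rule pullback_X[OF fa inj im \<phi>X])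
  have lam\<psi>: "lam ?T2 \<psi> = lam (S \<union> {a}) (\<phi> v)"
    unfolding \<psi>_def by (rule lam_pullback_bij[OF fa bij \<phi>X])
  have \<psi>\<chi>: "pullback id S ?T2 \<psi> = \<chi>"
  proof -
    have "pullback id S ?T2 \<psi> = pullback (id(v := a) \<circ> id) S (S \<union> {a}) (\<phi> v)"
      unfolding \<psi>_def by (rule pullback_comp[OF X_chars[OF fa \<phi>X] fa inj im]) auto
    also have "\<dots> = \<chi>" unfolding \<phi>\<chi>[symmetric] by (rule pullback_cong) (use v in auto)
    finally show ?thesis .
  qed
  have r1: "coord W (?r1 \<omega>) u = coord (insert v W) \<omega> u" if "\<omega> \<in> X ?T" "u \<in> W" for \<omega> u
  proof -
    have "coord W (?r1 \<omega>) u = pullback (id \<circ> id(a := u)) (S \<union> {a}) ?T \<omega>"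
      unfolding coord_def
      by (rule pullback_comp[OF X_chars[OF fin(3) that(1)] fin(3)])
        (use that insert.prems a in \<open>auto simp: inj_on_def\<close>)
    then show ?thesis by (simp add: coord_def)
  qed
  have res1: "pullback id S ?T1 (?r1 \<omega>) = pullback id S ?T \<omega>" if "\<omega> \<in> X ?T" for \<omega>
    using pullback_comp[OF X_chars[OF fin(3) that] fin(3), of id ?T1 id S] by auto
  have r1X: "?r1 \<omega> \<in> X ?T1" if "\<omega> \<in> X ?T" for \<omega>
    by (rule pullback_X[OF fin(3) _ _ that]) auto
  have r2: "coord (insert v W) \<omega> v = \<phi> v \<longleftrightarrow> ?r2 \<omega> = \<psi>" if \<omega>: "\<omega> \<in> X ?T" for \<omega>
  proof
    assume *: "coord (insert v W) \<omega> v = \<phi> v"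
    have "\<psi> = pullback (id(a := v) \<circ> id(v := a)) ?T2 ?T \<omega>"
      unfolding \<psi>_def *[symmetric] coord_def
      by (rule pullback_comp[OF X_chars[OF fin(3) \<omega>] fin(3) inj' _ inj im]) auto
    also have "\<dots> = ?r2 \<omega>" by (rule pullback_cong) (use a in auto)
    finally show "?r2 \<omega> = \<psi>" by simp
  next
    assume *: "?r2 \<omega> = \<psi>"
    have "coord (insert v W) \<omega> v = pullback (id \<circ> id(a := v)) (S \<union> {a}) ?T \<omega>" by (simp add: coord_def)
    also have "\<dots> = pullback (id(a := v)) (S \<union> {a}) ?T2 (?r2 \<omega>)"
      by (rule pullback_comp[OF X_chars[OF fin(3) \<omega>] fin(3) _ _ inj', symmetric]) auto
    also have "\<dots> = pullback (id(v := a) \<circ> id(a := v)) (S \<union> {a}) (S \<union> {a}) (\<phi> v)"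
      unfolding * \<psi>_def by (rule pullback_comp[OF X_chars[OF fa \<phi>X] fa inj im inj']) auto
    also have "\<dots> = pullback id (S \<union> {a}) (S \<union> {a}) (\<phi> v)"
      by (rule pullback_cong) (use v in auto)
    also have "\<dots> = \<phi> v" by (rule pullback_id[OF X_chars[OF fa \<phi>X] fa])
    finally show "coord (insert v W) \<omega> v = \<phi> v" .
  qed
  let ?A = "{\<omega>. \<omega> \<in> extensions X S \<chi> (insert v W) \<and> (\<forall>u\<in>insert v W. coord (insert v W) \<omega> u = \<phi> u)}"
  let ?B = "{\<omega>. \<omega> \<in> extensions X S \<chi> W \<and> (\<forall>u\<in>W. coord W \<omega> u = \<phi> u)}"
  \<comment> \<open>Membership splits into a condition at \<open>v\<close> and one on the
    restriction to \<open>W\<close>, so the sum can be grouped along \<open>?r1\<close>.\<close>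
  have A: "\<omega> \<in> ?A \<longleftrightarrow> \<omega> \<in> X ?T \<and> ?r2 \<omega> = \<psi> \<and> ?r1 \<omega> \<in> ?B" for \<omega>
    using r1 r2 res1 r1X by (auto simp: extensions_def)
  have "(\<Sum>\<omega>\<in>?A. lam ?T \<omega>) = (\<Sum>\<omega>1\<in>?B. \<Sum>\<omega> | \<omega> \<in> ?A \<and> ?r1 \<omega> = \<omega>1. lam ?T \<omega>)"
  proof (rule sum.group[symmetric])
    show "finite ?A" "finite ?B" using finite_X fin by (auto simp: extensions_def)
    show "?r1 ` ?A \<subseteq> ?B" using A by blast
  qed
  also have "\<dots> = (\<Sum>\<omega>1\<in>?B. lam ?T1 \<omega>1 * (lam (S \<union> {a}) (\<phi> v) / lam S \<chi>))"
  proof (rule sum.cong[OF refl])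
    fix \<omega>1 assume B: "\<omega>1 \<in> ?B"
    have "{\<omega>. \<omega> \<in> ?A \<and> ?r1 \<omega> = \<omega>1} = {\<omega>. \<omega> \<in> X ?T \<and> ?r2 \<omega> = \<psi> \<and> ?r1 \<omega> = \<omega>1}"
      using A B by blast
    moreover have "\<omega>1 \<in> X ?T1" "pullback id S ?T1 \<omega>1 = \<chi>" using B by (auto simp: extensions_def)
    ultimately show "(\<Sum>\<omega> | \<omega> \<in> ?A \<and> ?r1 \<omega> = \<omega>1. lam ?T \<omega>) =
        lam ?T1 \<omega>1 * (lam (S \<union> {a}) (\<phi> v) / lam S \<chi>)"
      using amalgamation[OF fin(1,2) _ \<psi>X, unfolded T, of \<omega>1 \<chi>] \<psi>\<chi> lam\<psi> by simp
  qed
  also have "\<dots> = lam S \<chi> * (\<Prod>v\<in>W. lam (S \<union> {a}) (\<phi> v) / lam S \<chi>) * (lam (S \<union> {a}) (\<phi> v) / lam S \<chi>)"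
    unfolding sum_distrib_right[symmetric] using insert.IH insert.prems by simp
  finally show ?case using insert.hyps by simp
qed

text \<open>The total weight in \<open>weight_sum\<close> is nonzero, so its index set cannot be
  empty.\<close>

lemma coord_surj:
  assumes W: "finite W" "W \<inter> S = {}" and \<phi>: "\<forall>v\<in>W. \<phi> v \<in> points"
  obtains \<omega> where "\<omega> \<in> extensions X S \<chi> W" "\<forall>v\<in>W. coord W \<omega> v = \<phi> v"
proof -
  have "lam (S \<union> {a}) (\<phi> v) \<noteq> 0" if "v \<in> W" for v
    using lam_nonzero[of "S \<union> {a}" "\<phi> v"] S \<phi> that by (auto simp: extensions_def)
  then have "lam S \<chi> * (\<Prod>v\<in>W. lam (S \<union> {a}) (\<phi> v) / lam S \<chi>) \<noteq> 0"
    using W lam_nonzero[OF S \<chi>] by auto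
  then have "{\<omega>. \<omega> \<in> extensions X S \<chi> W \<and> (\<forall>v\<in>W. coord W \<omega> v = \<phi> v)} \<noteq> {}"
    using weight_sum[OF assms] by fastforce
  then show ?thesis using that by blast
qed

lemma coord_image:
  assumes W: "finite W" "W \<inter> S = {}"
  shows "(\<lambda>\<omega>. restrict (coord W \<omega>) W) ` extensions X S \<chi> W = W \<rightarrow>\<^sub>E points"
proof (intro equalityI subsetI)
  fix \<phi> assume "\<phi> \<in> (\<lambda>\<omega>. restrict (coord W \<omega>) W) ` extensions X S \<chi> W"
  then show "\<phi> \<in> W \<rightarrow>\<^sub>E points" using coord_points[OF W] by auto
next
  fix \<phi> assume \<phi>: "\<phi> \<in> W \<rightarrow>\<^sub>E points"
  then have "\<forall>v\<in>W. \<phi> v \<in> points" by auto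
  from coord_surj[OF W this] obtain \<omega> where \<omega>: "\<omega> \<in> extensions X S \<chi> W" "\<forall>v\<in>W. coord W \<omega> v = \<phi> v" .
  then have "restrict (coord W \<omega>) W = \<phi>"
    using restrict_eq_PiE_iff[OF \<phi>] by blast
  then show "\<phi> \<in> (\<lambda>\<omega>. restrict (coord W \<omega>) W) ` extensions X S \<chi> W" using \<omega>(1) by blast
qed

lemma finite_extensions: "finite W \<Longrightarrow> finite (extensions X S \<chi> W)"
  using finite_X[of "S \<union> W"] S by (simp add: extensions_def)

lemma card_points_power_le:
  assumes W: "finite W" "W \<inter> S = {}"
  shows "card points ^ card W \<le> card (extensions X S \<chi> W)"
  using card_image_le[OF finite_extensions[OF W(1)], of "\<lambda>\<omega>. restrict (coord W \<omega>) W"]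
  unfolding coord_image[OF W] using W by (simp add: card_PiE)

text \<open>Any \<open>m\<close> further labels give at least \<open>card points ^ m\<close>
  extensions, all within \<open>X (S \<union> W)\<close>; letting \<open>m\<close> grow makes the
  share of \<open>S\<close> in the exponent negligible.\<close>

lemma card_points: "card points \<le> q"
proof (rule le_of_powers_le[where k = "card S"])
  fix m :: nat
  have "infinite (- S)" using S by (simp add: finite_compl)
  then obtain W where W: "W \<subseteq> - S" "finite W" "card W = m"
    using infinite_arbitrarily_large by blast
  then have "card points ^ m \<le> card (extensions X S \<chi> W)"
    using card_points_power_le[of W] by auto
  also have "\<dots> \<le> card (X (S \<union> W))"
    using finite_X[of "S \<union> W"] S W by (intro card_mono) (auto simp: extensions_def)
  also have "\<dots> \<le> q ^ (card S + m)"
    using card_X[of "S \<union> W"] card_Un_disjoint[of S W] S W by fastforce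
  finally show "card points ^ m \<le> q ^ (card S + m)" .
qed

end

section \<open>The base with most one-label extensions and the target graph\<close>

locale maximal_character_system = based_character_system +
  assumes maximal: "finite T \<Longrightarrow> \<theta> \<in> X T \<Longrightarrow> v \<notin> T \<Longrightarrow>
    card (extensions X T \<theta> {v}) \<le> card (extensions X S \<chi> {a})"
begin

text \<open>Labels are added one at a time: each extension obtained so far is itself a base
  character, and by maximality it has at most \<open>card points\<close> one-label
  extensions.\<close>

lemma card_extensions_le:
  assumes "finite W" "W \<inter> S = {}"
  shows "card (extensions X S \<chi> W) \<le> card points ^ card W"
  using assms
proof (induction W rule: finite_induct)
  case empty
  have "extensions X S \<chi> {} \<subseteq> {\<chi>}"
    using pullback_id[OF X_chars[OF S] S] by (auto simp: extensions_def)
  then show ?case using card_mono[of "{\<chi>}"] by simp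
next
  case (insert v W)
  let ?T1 = "S \<union> W" and ?T = "S \<union> insert v W"
  let ?r = "pullback id ?T1 ?T"
  have fin: "finite ?T1" "finite ?T" using S insert.hyps by auto
  have res: "pullback id S ?T1 (?r \<omega>) = pullback id S ?T \<omega>" if "\<omega> \<in> X ?T" for \<omega>
    using pullback_comp[OF X_chars[OF fin(2) that] fin(2), of id ?T1 id S] by auto
  have rX: "?r \<omega> \<in> X ?T1" if "\<omega> \<in> X ?T" for \<omega>
    by (rule pullback_X[OF fin(2) _ _ that]) auto
  have sub: "extensions X S \<chi> (insert v W) \<subseteq> (\<Union>\<theta>\<in>extensions X S \<chi> W. extensions X ?T1 \<theta> {v})"
    using res rX by (auto simp: extensions_def)
  have ext: "card (extensions X ?T1 \<theta> {v}) \<le> card points" if "\<theta> \<in> extensions X S \<chi> W" for \<theta>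
    using maximal[OF fin(1), of \<theta> v] that insert by (auto simp: extensions_def)
  have "finite (\<Union>\<theta>\<in>extensions X S \<chi> W. extensions X ?T1 \<theta> {v})"
    using finite_extensions[OF insert.hyps(1)] finite_X[OF fin(2)] by (auto simp: extensions_def)
  from card_mono[OF this sub]
  have "card (extensions X S \<chi> (insert v W)) \<le> card (\<Union>\<theta>\<in>extensions X S \<chi> W. extensions X ?T1 \<theta> {v})" .
  also have "\<dots> \<le> (\<Sum>\<theta>\<in>extensions X S \<chi> W. card (extensions X ?T1 \<theta> {v}))"
    by (rule card_UN_le[OF finite_extensions[OF insert.hyps(1)]])
  also have "\<dots> \<le> card (extensions X S \<chi> W) * card points"
    using sum_bounded_above[OF ext] by simp
  also have "\<dots> \<le> card points ^ card W * card points"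
    using insert.IH insert.prems by (intro mult_right_mono) auto
  finally show ?case using insert.hyps by (simp add: mult.commute)
qed

text \<open>The coordinates map the extensions onto all functions from \<open>W\<close> to
  \<open>points\<close>, and there are no more extensions than such functions.\<close>

lemma coord_inj:
  assumes W: "finite W" "W \<inter> S = {}" and \<omega>: "\<omega> \<in> extensions X S \<chi> W" "\<omega>' \<in> extensions X S \<chi> W"
    and eq: "\<And>v. v \<in> W \<Longrightarrow> coord W \<omega> v = coord W \<omega>' v"
  shows "\<omega> = \<omega>'"
proof -
  have "card ((\<lambda>\<omega>. restrict (coord W \<omega>) W) ` extensions X S \<chi> W) = card (extensions X S \<chi> W)"
    using card_extensions_le[OF W] card_points_power_le[OF W] W
    unfolding coord_image[OF W] by (simp add: card_PiE)
  then have "inj_on (\<lambda>\<omega>. restrict (coord W \<omega>) W) (extensions X S \<chi> W)"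
    by (rule eq_card_imp_inj_on[OF finite_extensions[OF W(1)]])
  moreover have "restrict (coord W \<omega>) W = restrict (coord W \<omega>') W" using eq by (auto simp: restrict_def)
  ultimately show ?thesis using \<omega> by (auto dest: inj_onD)
qed

text \<open>A second model label, since an edge weight needs two labeled ends.\<close>

definition b :: nat where "b = (SOME b. b \<notin> S \<union> {a})"

lemma b: "b \<notin> S" "b \<noteq> a"
proof -
  have "\<exists>b. b \<notin> S \<union> {a}" using S by (intro ex_new_if_finite) auto
  from someI_ex[OF this] show "b \<notin> S" "b \<noteq> a" by (auto simp: b_def)
qed

definition edge_graph :: "nat set \<Rightarrow> nat set \<Rightarrow> mgraph" where
  "edge_graph T e = \<lparr>verts = T, edges = {#e#}\<rparr>"

text \<open>For two points, the chosen \<open>\<omega>\<close> exists by \<open>coord_surj\<close>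
  and is unique by \<open>coord_inj\<close>.\<close>

definition bond :: "(mgraph \<Rightarrow> 'a) \<Rightarrow> (mgraph \<Rightarrow> 'a) \<Rightarrow> 'a" where
  "bond \<psi> \<psi>' = (SOME \<omega>. \<omega> \<in> extensions X S \<chi> {a, b} \<and> coord {a, b} \<omega> a = \<psi> \<and> coord {a, b} \<omega> b = \<psi>')
     (edge_graph (S \<union> {a, b}) {a, b})"

text \<open>Pulling \<open>\<omega>\<close> back along the map from \<open>a\<close>,
  \<open>b\<close> to \<open>u\<close>, \<open>v\<close> gives a character whose coordinates are
  those of \<open>\<omega>\<close> at \<open>u\<close> and \<open>v\<close>. By uniqueness it is the
  one chosen in \<open>bond\<close>, and its edge corresponds to \<open>{u, v}\<close>.\<close>

lemma edge_value:
  assumes W: "finite W" "W \<inter> S = {}" and \<omega>: "\<omega> \<in> extensions X S \<chi> W" and uv: "u \<in> W" "v \<in> W" "u \<noteq> v"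
  shows "\<omega> (edge_graph (S \<union> W) {u, v}) = bond (coord W \<omega> u) (coord W \<omega> v)"
proof -
  let ?T = "S \<union> W" and ?B = "S \<union> {a, b}"
  have \<omega>X: "\<omega> \<in> X ?T" and res: "pullback id S ?T \<omega> = \<chi>" using \<omega> by (auto simp: extensions_def)
  have T: "finite ?T" using S W by simp
  define \<sigma> where "\<sigma> = id(a := u, b := v)"
  have \<sigma>: "inj_on \<sigma> ?B" "\<sigma> ` ?B \<subseteq> ?T" "\<And>w. w \<in> S \<Longrightarrow> \<sigma> w = w" "\<sigma> a = u" "\<sigma> b = v"
    using a b uv W by (auto simp: \<sigma>_def inj_on_def)
  define \<omega>0 where "\<omega>0 = pullback \<sigma> ?B ?T \<omega>"
  have \<omega>0X: "\<omega>0 \<in> X ?B" unfolding \<omega>0_def by (rule pullback_X[OF T \<sigma>(1,2) \<omega>X])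
  note comp = pullback_comp[OF X_chars[OF T \<omega>X] T \<sigma>(1,2), folded \<omega>0_def]
  have "pullback id S ?B \<omega>0 = pullback (\<sigma> \<circ> id) S ?T \<omega>" by (rule comp) auto
  also have "\<dots> = \<chi>" unfolding res[symmetric] by (rule pullback_cong) (use \<sigma> in auto)
  finally have ext: "\<omega>0 \<in> extensions X S \<chi> {a, b}" using \<omega>0X by (simp add: extensions_def)
  have c: "coord {a, b} \<omega>0 w = coord W \<omega> (\<sigma> w)" if "w \<in> {a, b}" for w
  proof -
    have "coord {a, b} \<omega>0 w = pullback (\<sigma> \<circ> id(a := w)) (S \<union> {a}) ?T \<omega>"
      unfolding coord_def by (rule comp) (use that a b in \<open>auto simp: inj_on_def\<close>)
    also have "\<dots> = coord W \<omega> (\<sigma> w)"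
      unfolding coord_def by (rule pullback_cong) (use a \<sigma>(3) in auto)
    finally show ?thesis .
  qed
  have "(SOME \<omega>'. \<omega>' \<in> extensions X S \<chi> {a, b} \<and> coord {a, b} \<omega>' a = coord W \<omega> u \<and>
      coord {a, b} \<omega>' b = coord W \<omega> v) = \<omega>0"
  proof (rule some_equality)
    show "\<omega>' = \<omega>0" if "\<omega>' \<in> extensions X S \<chi> {a, b} \<and> coord {a, b} \<omega>' a = coord W \<omega> u \<and>
      coord {a, b} \<omega>' b = coord W \<omega> v" for \<omega>'
      by (rule coord_inj[of "{a, b}"]) (use that ext c \<sigma> a b in auto)
  qed (use ext c \<sigma> in auto)
  then have "bond (coord W \<omega> u) (coord W \<omega> v) = \<omega>0 (edge_graph ?B {a, b})"
    by (simp add: bond_def)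
  also have "\<dots> = \<omega> (gsum (edgeless ?T) (rename (extend \<sigma> ?B ?T) (edge_graph ?B {a, b})))"
  proof -
    have "edge_graph ?B {a, b} \<in> graphs_on ?B"
      using S b by (auto simp: graphs_on_def graph_def edge_graph_def)
    then show ?thesis by (simp only: \<omega>0_def pullback_def if_True)
  qed
  also have "gsum (edgeless ?T) (rename (extend \<sigma> ?B ?T) (edge_graph ?B {a, b})) = edge_graph ?T {u, v}"
    using \<sigma>(2,4,5) by (intro mgraph_eqI) (auto simp: edge_graph_def)
  finally show ?thesis by simp
qed

text \<open>An edge is an unordered pair: one amalgam, read at \<open>a, b\<close> and at
  \<open>b, a\<close>, gives both values.\<close>

lemma bond_commute:
  assumes "\<psi> \<in> points" "\<psi>' \<in> points"
  shows "bond \<psi> \<psi>' = bond \<psi>' \<psi>"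
proof -
  have W: "finite {a, b}" "{a, b} \<inter> S = {}" using a b by auto
  obtain \<omega> where "\<omega> \<in> extensions X S \<chi> {a, b}" "\<forall>v\<in>{a, b}. coord {a, b} \<omega> v = (if v = a then \<psi> else \<psi>')"
    by (rule coord_surj[OF W, of "\<lambda>v. if v = a then \<psi> else \<psi>'"]) (use assms in auto)
  then show ?thesis
    using edge_value[OF W, of \<omega> a b] edge_value[OF W, of \<omega> b a] b by (simp add: insert_commute)
qed

text \<open>When all nodes are labeled, a graph is the product of its single edges.\<close>

lemma chars_edges:
  assumes \<omega>: "\<omega> \<in> chars T" and T: "finite T" and M: "\<forall>e\<in>#M. e \<subseteq> T \<and> card e = 2"
  shows "\<omega> \<lparr>verts = T, edges = M\<rparr> = (\<Prod>e\<in>#M. \<omega> (edge_graph T e))"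
  using M
proof (induction M)
  case empty
  then show ?case using chars_edgeless[OF \<omega>] by (simp add: edgeless_def)
next
  case (add e M)
  have "\<lparr>verts = T, edges = add_mset e M\<rparr> = gsum (edge_graph T e) \<lparr>verts = T, edges = M\<rparr>"
    by (rule mgraph_eqI) (auto simp: edge_graph_def)
  moreover have "\<omega> \<dots> = \<omega> (edge_graph T e) * \<omega> \<lparr>verts = T, edges = M\<rparr>"
    by (rule chars_gsum[OF \<omega>]) (use add.prems T in \<open>auto simp: graphs_on_def graph_def edge_graph_def\<close>)
  ultimately show ?case using add by simp
qed

text \<open>Without labels there is at most \<open>q ^ 0 = 1\<close> character, and its weight is
  the value of \<open>f\<close> at the empty graph, which is 1. So \<open>f\<close> is that
  character, and it is the restriction of \<open>\<chi>\<close>.\<close>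

lemma f_eq_character:
  assumes G: "graph G" "verts G \<inter> S = {}"
  shows "f G = \<chi> (gsum (edgeless S) G)"
proof -
  define \<theta> where "\<theta> = pullback id {} S \<chi>"
  have \<theta>: "\<theta> \<in> X {}" unfolding \<theta>_def by (rule pullback_X[OF S _ _ \<chi>]) auto
  have X1: "X {} = {\<theta>}"
  proof -
    have "card (X {}) \<le> 1" "finite (X {})" using card_X[of "{}"] finite_X[of "{}"] by simp_all
    then have "\<forall>\<eta>\<in>X {}. \<eta> = \<theta>" using \<theta> by (simp add: card_le_Suc0_iff_eq)
    then show ?thesis using \<theta> by blast
  qed
  have "lam {} \<theta> = 1"
    using f_eq[of "{}" "edgeless {}"] f_empty chars_edgeless[OF X_chars[OF _ \<theta>]]
      edgeless_graphs_on[of "{}"] by (simp add: X1)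
  moreover have G0: "G \<in> graphs_on {}" using G by (simp add: graphs_on_def)
  ultimately have "f G = \<theta> G" using f_eq[of "{}" G] by (simp add: X1)
  also have "\<dots> = \<chi> (gsum (edgeless S) G)"
    unfolding \<theta>_def by (rule pullback_inclusion[OF X_chars[OF S \<chi>] S _ G0]) (use G in auto)
  finally show ?thesis .
qed

text \<open>Expand \<open>\<chi>\<close> over its extensions to all the nodes of \<open>G\<close>.
  Each extension factors over the edges and its value depends only on its coordinates, so the terms
  are grouped by coordinates and \<open>weight_sum\<close> evaluates each group.\<close>

lemma f_eq_sum:
  assumes G: "graph G" "verts G \<inter> S = {}"
  shows "f G = (\<Sum>\<phi>\<in>verts G \<rightarrow>\<^sub>E points. (\<Prod>v\<in>verts G. lam (S \<union> {a}) (\<phi> v) / lam S \<chi>) *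
    (\<Prod>e\<in>#edges G. bond (\<phi> (Min e)) (\<phi> (Max e))))"
proof -
  let ?W = "verts G"
  let ?T = "S \<union> ?W" and ?E = "extensions X S \<chi> ?W"
  let ?G = "gsum (edgeless S) G"
  let ?c = "\<lambda>\<omega>. restrict (coord ?W \<omega>) ?W"
  let ?w = "\<lambda>\<phi>. \<Prod>v\<in>?W. lam (S \<union> {a}) (\<phi> v) / lam S \<chi>"
  let ?e = "\<lambda>\<phi>. \<Prod>e\<in>#edges G. bond (\<phi> (Min e)) (\<phi> (Max e))"
  have W: "finite ?W" using G by (simp add: graph_def)
  have T: "finite ?T" using S W by simp
  have lam: "lam S \<chi> \<noteq> 0" using lam_nonzero[OF S \<chi>] .
  have GT: "?G \<in> graphs_on ?T" using G S by (auto simp: graphs_on_def)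
  have val: "\<omega> ?G = ?e (?c \<omega>)" if \<omega>: "\<omega> \<in> ?E" for \<omega>
  proof -
    have \<omega>X: "\<omega> \<in> X ?T" using \<omega> by (simp add: extensions_def)
    have "?G = \<lparr>verts = ?T, edges = edges G\<rparr>" by (rule mgraph_eqI) auto
    then have "\<omega> ?G = \<omega> \<lparr>verts = ?T, edges = edges G\<rparr>" by (rule arg_cong)
    also have "\<dots> = (\<Prod>e\<in>#edges G. \<omega> (edge_graph ?T e))"
      using chars_edges[OF X_chars[OF T \<omega>X] T, of "edges G"] G by (auto simp: graph_def)
    also have "\<dots> = ?e (?c \<omega>)"
    proof (intro arg_cong[where f = prod_mset] image_mset_cong)
      fix e assume "e \<in># edges G"
      then have e: "e \<subseteq> ?W" "card e = 2" using G by (auto simp: graph_def)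
      \<comment> \<open>Naming the smaller end \<open>u\<close> matches the reading of an edge by
        \<open>Min\<close> and \<open>Max\<close>.\<close>
      then obtain u v where uv: "e = {u, v}" "u < v"
        by (metis card_2_iff insert_commute linorder_neqE_nat)
      then have "Min e = u" "Max e = v" by auto
      then show "\<omega> (edge_graph ?T e) = bond (?c \<omega> (Min e)) (?c \<omega> (Max e))"
        using edge_value[OF W G(2) \<omega>, of u v] e uv by simp
    qed
    finally show ?thesis .
  qed
  have "lam S \<chi> * f G = (\<Sum>\<omega>\<in>?E. lam ?T \<omega> * ?e (?c \<omega>))"
    using restriction_sum[OF T _ GT \<chi>] f_eq_character[OF G] val
    by (simp add: extensions_def)
  also have "\<dots> = (\<Sum>\<phi>\<in>?W \<rightarrow>\<^sub>E points. \<Sum>\<omega> | \<omega> \<in> ?E \<and> ?c \<omega> = \<phi>. lam ?T \<omega> * ?e (?c \<omega>))"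
  proof (rule sum.group[symmetric])
    show "finite (?W \<rightarrow>\<^sub>E points)" using W finite_extensions by (intro finite_PiE) auto
    show "?c ` ?E \<subseteq> ?W \<rightarrow>\<^sub>E points" using coord_image[OF W G(2)] by simp
  qed (use finite_extensions W in auto)
  also have "\<dots> = (\<Sum>\<phi>\<in>?W \<rightarrow>\<^sub>E points. lam S \<chi> * (?w \<phi> * ?e \<phi>))"
  proof (rule sum.cong[OF refl])
    fix \<phi> assume \<phi>: "\<phi> \<in> ?W \<rightarrow>\<^sub>E points"
    note iff = restrict_eq_PiE_iff[OF \<phi>]
    have "(\<Sum>\<omega> | \<omega> \<in> ?E \<and> ?c \<omega> = \<phi>. lam ?T \<omega> * ?e (?c \<omega>)) =
        (\<Sum>\<omega> | \<omega> \<in> ?E \<and> ?c \<omega> = \<phi>. lam ?T \<omega>) * ?e \<phi>"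
      unfolding sum_distrib_right by (rule sum.cong) auto
    also have "\<dots> = lam S \<chi> * ?w \<phi> * ?e \<phi>"
      unfolding iff using weight_sum[OF W G(2), of \<phi>] \<phi> by auto
    finally show "(\<Sum>\<omega> | \<omega> \<in> ?E \<and> ?c \<omega> = \<phi>. lam ?T \<omega> * ?e (?c \<omega>)) = lam S \<chi> * (?w \<phi> * ?e \<phi>)"
      by simp
  qed
  also have "\<dots> = lam S \<chi> * (\<Sum>\<phi>\<in>?W \<rightarrow>\<^sub>E points. ?w \<phi> * ?e \<phi>)" by (simp add: sum_distrib_left)
  finally show ?thesis using lam by simp
qed

lemma hom_representation:
  "\<exists>H :: 'a wgraph. weighted_graph H \<and> wsize H \<le> q \<and> (\<forall>G. graph G \<longrightarrow> f G = hom G H)"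
proof -
  let ?D = "card points"
  have fin: "finite points" using finite_extensions by simp
  obtain g where g: "bij_betw g {1..?D} points"
    using ex_bij_betw_nat_finite_1[OF fin] by blast
  define H where "H = \<lparr>wsize = ?D, vweight = \<lambda>i. lam (S \<union> {a}) (g i) / lam S \<chi>,
    eweight = \<lambda>i j. bond (g i) (g j)\<rparr>"
  have gp: "g i \<in> points" if "i \<in> {1..?D}" for i using g that by (auto simp: bij_betw_def)
  have "weighted_graph H"
    unfolding weighted_graph_def
  proof (intro conjI ballI)
    fix i assume "i \<in> {1..wsize H}"
    then have "g i \<in> points" using gp by (simp add: H_def)
    then show "vweight H i \<noteq> 0"
      using lam_nonzero[OF S \<chi>] lam_nonzero[of "S \<union> {a}" "g i"] S by (simp add: H_def extensions_def)
  next
    fix i j assume "i \<in> {1..wsize H}" "j \<in> {1..wsize H}"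
    then show "eweight H i j = eweight H j i"
      using bond_commute[OF gp gp] by (simp add: H_def)
  qed
  moreover have "f G = hom G H" if G: "graph G" for G
  proof -
    \<comment> \<open>This moves the nodes off \<open>S\<close>, as \<open>f_eq_sum\<close>
      requires; being strictly increasing, it preserves which end of an edge is the minimum.\<close>
    define \<tau> where "\<tau> v = v + Suc (\<Sum>S)" for v
    have \<tau>: "strict_mono \<tau>" by (auto simp: \<tau>_def strict_mono_def)
    then have inj: "inj_on \<tau> A" for A using strict_mono_imp_inj_on inj_on_subset by blast
    let ?V = "verts G" and ?G = "rename \<tau> G"
    have V: "finite ?V" using G by (simp add: graph_def)
    let ?F = "\<lambda>\<phi>. (\<Prod>v\<in>\<tau> ` ?V. lam (S \<union> {a}) (\<phi> v) / lam S \<chi>) *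
      (\<Prod>e\<in>#edges ?G. bond (\<phi> (Min e)) (\<phi> (Max e)))"
    let ?j = "\<lambda>\<phi>. \<lambda>w\<in>\<tau> ` ?V. g (\<phi> (inv_into ?V \<tau> w))"
    let ?i = "\<lambda>\<phi>. \<lambda>v\<in>?V. inv_into {1..?D} g (\<phi> (\<tau> v))"
    have "f G = f ?G" using f_rename[OF G inj] by simp
    also have "\<dots> = (\<Sum>\<phi>\<in>\<tau> ` ?V \<rightarrow>\<^sub>E points. ?F \<phi>)"
      using f_eq_sum[OF graph_rename[OF G inj]] shift_fresh[OF S] by (auto simp: \<tau>_def)
    also have "\<dots> = hom G H"
      unfolding hom_def
    proof (rule sum.reindex_bij_witness[where i = ?j and j = ?i])
      fix \<phi> assume \<phi>: "\<phi> \<in> \<tau> ` ?V \<rightarrow>\<^sub>E points"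
      then have gi: "g (inv_into {1..?D} g (\<phi> (\<tau> v))) = \<phi> (\<tau> v)" if "v \<in> ?V" for v
        using that g by (intro bij_betw_inv_into_right[OF g]) auto
      show "?j (?i \<phi>) = \<phi>"
      proof
        fix w show "?j (?i \<phi>) w = \<phi> w"
          using gi PiE_arb[OF \<phi>, of w] by (cases "w \<in> \<tau> ` ?V") (auto simp: inv_into_f_f[OF inj])
      qed
      show "?i \<phi> \<in> ?V \<rightarrow>\<^sub>E {1..wsize H}"
        using \<phi> g by (auto simp: H_def bij_betw_def inv_into_into intro!: inv_into_into)
      have "(\<Prod>v\<in>?V. vweight H (?i \<phi> v)) = (\<Prod>v\<in>\<tau> ` ?V. lam (S \<union> {a}) (\<phi> v) / lam S \<chi>)"
        using gi by (simp add: prod.reindex[OF inj] H_def)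
      moreover have "(\<Prod>e\<in>#edges G. eweight H (?i \<phi> (Min e)) (?i \<phi> (Max e))) =
          (\<Prod>e\<in>#edges ?G. bond (\<phi> (Min e)) (\<phi> (Max e)))"
        unfolding edges_simps multiset.map_comp
      proof (intro arg_cong[where f = prod_mset] image_mset_cong)
        fix e assume "e \<in># edges G"
        then have e: "e \<subseteq> ?V" "card e = 2" using G by (auto simp: graph_def)
        then have ne: "finite e" "e \<noteq> {}" by (auto intro: card_ge_0_finite)
        then have "Min e \<in> ?V" "Max e \<in> ?V" using e Min_in Max_in by blast+
        moreover have "Min (\<tau> ` e) = \<tau> (Min e)" "Max (\<tau> ` e) = \<tau> (Max e)"
          using mono_Min_commute[OF strict_mono_mono[OF \<tau>] ne] mono_Max_commute[OF strict_mono_mono[OF \<tau>] ne]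
          by simp_all
        ultimately show "eweight H (?i \<phi> (Min e)) (?i \<phi> (Max e)) =
            ((\<lambda>e. bond (\<phi> (Min e)) (\<phi> (Max e))) \<circ> (`) \<tau>) e"
          using gi by (simp add: H_def)
      qed
      ultimately show "(\<Prod>u\<in>?V. vweight H (?i \<phi> u)) * (\<Prod>e\<in>#edges G. eweight H (?i \<phi> (Min e)) (?i \<phi> (Max e))) = ?F \<phi>"
        by simp
    next
      fix \<phi> assume \<phi>: "\<phi> \<in> ?V \<rightarrow>\<^sub>E {1..wsize H}"
      show "?i (?j \<phi>) = \<phi>"
      proof
        fix v show "?i (?j \<phi>) v = \<phi> v"
        proof (cases "v \<in> ?V")
          case True
          then have "\<phi> v \<in> {1..?D}" using PiE_mem[OF \<phi>] by (simp add: H_def)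
          from bij_betw_inv_into_left[OF g this] show ?thesis
            using True by (simp add: inv_into_f_f[OF inj])
        qed (simp add: PiE_arb[OF \<phi>])
      qed
      show "?j \<phi> \<in> \<tau> ` ?V \<rightarrow>\<^sub>E points"
        using \<phi> gp by (auto simp: inv_into_f_f[OF inj] H_def Pi_iff PiE_def)
    qed
    finally show ?thesis .
  qed
  ultimately show ?thesis using card_points by (intro exI[of _ H]) (simp add: H_def)
qed

end

text \<open>The number of one-label extensions is at most \<open>q\<close> for every base, so some
  base attains the largest number.\<close>

lemma (in character_system) hom_representation:
  "\<exists>H :: 'a wgraph. weighted_graph H \<and> wsize H \<le> q \<and> (\<forall>G. graph G \<longrightarrow> f G = hom G H)"
proof -
  let ?P = "\<lambda>(S, \<chi>, a). finite S \<and> \<chi> \<in> X S \<and> a \<notin> S"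
  let ?d = "\<lambda>(S, \<chi>, a). card (extensions X S \<chi> {a})"
  \<comment> \<open>An empty \<open>X {}\<close> would make \<open>f\<close> vanish on the empty
    graph.\<close>
  have "X {} \<noteq> {}"
    using f_eq[of "{}" "edgeless {}"] f_empty edgeless_graphs_on[of "{}"] by auto
  then obtain \<chi> where "\<chi> \<in> X {}" by blast
  then have P: "?P ({}, \<chi>, 0)" by simp
  have "?d y \<le> q" if "?P y" for y
  proof -
    obtain S \<chi> a where y: "y = (S, \<chi>, a)" by (cases y)
    interpret based_character_system f q X lam S \<chi> a by unfold_locales (use that y in auto)
    show ?thesis using card_points y by simp
  qed
  then have "\<forall>y. ?P y \<longrightarrow> ?d y < Suc q" by (meson less_Suc_eq_le)
  from ex_has_greatest_nat[where P = ?P and f = ?d, OF P this]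
  obtain S \<chi> a where "?P (S, \<chi>, a)" and max: "\<forall>y. ?P y \<longrightarrow> ?d y \<le> ?d (S, \<chi>, a)" by auto
  then interpret maximal_character_system f q X lam S \<chi> a
    by unfold_locales auto
  show ?thesis by (rule hom_representation)
qed

section \<open>Conclusion from the rank hypothesis\<close>

lemma Inf_enat_in: "A \<noteq> {} \<Longrightarrow> Inf A \<in> A" for A :: "enat set"
  by (auto simp: Inf_enat_def intro: LeastI)

text \<open>A finite bound rules out the empty set of decomposition lengths, and a nonempty set of
  extended naturals contains its infimum.\<close>

lemma sym_rank_leD:
  assumes "sym_rank k n T \<le> enat m"
  shows "\<exists>r\<le>m. sym_decomposition k n T r"
proof -
  let ?A = "{enat r | r. sym_decomposition k n T r}"
  have "?A \<noteq> {}"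
  proof
    assume "?A = {}"
    then have "Inf ?A = \<infinity>" by (simp add: Inf_enat_def)
    then show False using assms by (simp add: sym_rank_def)
  qed
  then have "Inf ?A \<in> ?A" by (rule Inf_enat_in)
  then show ?thesis using assms by (auto simp: sym_rank_def)
qed

theorem theorem3p5:
  fixes f :: "mgraph \<Rightarrow> 'a::field" and q :: nat
  assumes "graph_parameter f"
    and "f K0 = 1"
    and "\<forall>k::nat. \<exists>n::nat. n \<ge> 2 \<and> sym_rank k n (conn_tensor f k) \<le> enat (min (n - 1) (q ^ k))"
  shows "\<exists>H :: 'a wgraph. weighted_graph H \<and> wsize H \<le> q \<and> (\<forall>G. graph G \<longrightarrow> f G = hom G H)"
proof -
  let ?Q = "\<lambda>S X l. finite X \<and> card X \<le> q ^ card S \<and> X \<subseteq> chars S \<and> (\<forall>\<chi>\<in>X. l \<chi> \<noteq> 0) \<and>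
    (\<forall>G\<in>graphs_on S. f G = (\<Sum>\<chi>\<in>X. l \<chi> * \<chi> G))"
  have "\<exists>p. ?Q S (fst p) (snd p)" if S: "finite S" for S
  proof -
    \<comment> \<open>The hypothesis is applied with \<open>k = card S\<close>: the bound by
      \<open>n - 1\<close> turns the terms into characters, the bound by \<open>q ^ k\<close> limits
      their number.\<close>
    obtain n r where n: "n \<ge> 2" "r \<le> n - 1" "r \<le> q ^ card S"
      "sym_decomposition (card S) n (conn_tensor f (card S)) r"
      using assms(3) by (meson sym_rank_leD min.bounded_iff)
    from character_decomposition[OF assms(1) S n(1,2,4)] n(3)
    obtain X l where "?Q S X l" by (meson le_trans)
    then show ?thesis by (intro exI[of _ "(X, l)"]) simp
  qed
  then have "\<forall>S\<in>Collect finite. \<exists>p. ?Q S (fst p) (snd p)" by simp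
  from bchoice[OF this] obtain p where p: "\<And>S. finite S \<Longrightarrow> ?Q S (fst (p S)) (snd (p S))" by auto
  interpret character_system f q "\<lambda>S. fst (p S)" "\<lambda>S. snd (p S)"
  proof
    show "f (rename \<tau> G) = f G" if "graph G" "inj_on \<tau> (verts G)" for G \<tau>
      using assms(1) that graph_rename[OF that] unfolding graph_parameter_def graph_iso_iff by metis
    show "f (edgeless {}) = 1" using assms(2) by (simp add: K0_def edgeless_def)
  qed (use p in blast)+
  show ?thesis by (rule hom_representation)
qed

end
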